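(* Let $d\ge1$, $n\ge2$, let $X=\{x_1,\dots,x_n\}\subset\mathbb{R}^d$ be distinct points, $m\colon\mathbb{R}^d\to\mathbb{R}$ a function, $Y=(y_1,\dots,y_n)\in\mathbb{R}^n$ and $Y_m=(y_i-m(x_i))_{i=1}^n$. Let $K(x,y)=\Phi(x-y)$, $x,y\in\mathbb{R}^d$, be a positive-definite kernel, where $\Phi\colon\mathbb{R}^d\to\mathbb{R}$ is continuous and integrable and there are constants $C_1,C_2>0$ and $\alpha>d/2$ such that $C_1(1+\|\xi\|^2)^{-\alpha}\le\widehat\Phi(\xi)\le C_2(1+\|\xi\|^2)^{-\alpha}$ for all $\xi\in\mathbb{R}^d$. For $\lambda,\sigma>0$ let $K_\lambda(x,y)=\Phi((x-y)/\lambda)$ and $$\ell(\lambda,\sigma\mid Y)=\frac1{\sigma^2}Y_m^{\mathsf T}K_\lambda(X,X)^{-1}Y_m+\log\det K_\lambda(X,X)+n\log\sigma^2,$$ let $\{\lambda_{\mathrm{ML}},\sigma_{\mathrm{ML}}\}\in\arg\min_{\lambda,\sigma>0}\ell(\lambda,\sigma\mid Y)$, and for fixed $\lambda>0$ let $\sigma_{\mathrm{ML}}(\lambda)$ be the minimiser of $\sigma\mapsto\ell(\lambda,\sigma\mid Y)$ over $\sigma>0$. If $Y$ is $m$-constant, i.e. $Y_m=(c,\dots,c)$ for some $c\in\mathbb{R}$, and $Y_m\ne0$, then $$\lim_{\lambda\to\infty}\ell(\lambda,\sigma_{\mathrm{ML}}(\lambda)\mid Y)=-\infty\quad\text{and}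\quad\lambda_{\mathrm{ML}}=\infty.$$
   Context: A kernel is a symmetric function $K\colon\mathbb{R}^d\times\mathbb{R}^d\to\mathbb{R}$; it is (strictly) positive-definite if $\sum_{i,j}a_ia_jK(z_i,z_j)>0$ for all $N\in\mathbb{N}$, all non-zero $a\in\mathbb{R}^N$ and all distinct $z_1,\dots,z_N$. $K_\lambda(X,X)=(K_\lambda(x_i,x_j))_{i,j=1}^n$. The Fourier transform is $\widehat f(\xi)=\int_{\mathbb{R}^d}f(x)e^{-\mathrm{i}\xi^{\mathsf T}x}\,dx$. Convention: $\lambda_{\mathrm{ML}}=\infty$ means that every sequence $(\lambda_k,\sigma_k)$ in $(0,\infty)^2$ with $\ell(\lambda_k,\sigma_k\mid Y)\to\inf_{\lambda,\sigma>0}\ell(\lambda,\sigma\mid Y)$ satisfies $\lambda_k\to\infty$. *)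

theory Defs
  imports "HOL-Analysis.Analysis"
begin

definition positive_definite_kernel :: "('a \<Rightarrow> 'a \<Rightarrow> real) \<Rightarrow> bool" where
  "positive_definite_kernel K \<longleftrightarrow>
     (\<forall>x y. K x y = K y x) \<and>
     (\<forall>(N::nat) (a::nat \<Rightarrow> real) (z::nat \<Rightarrow> 'a).
        inj_on z {..<N} \<and> (\<exists>i<N. a i \<noteq> 0) \<longrightarrow>
        (\<Sum>i<N. \<Sum>j<N. a i * a j * K (z i) (z j)) > 0)"

definition fourier_transform :: "('a::euclidean_space \<Rightarrow> real) \<Rightarrow> 'a \<Rightarrow> complex" where
  "fourier_transform f \<xi> =
     (LINT x|lborel. complex_of_real (f x) * exp (- (\<i> * complex_of_real (\<xi> \<bullet> x))))"

definition scaled_kernel :: "('a::real_vector \<Rightarrow> real) \<Rightarrow> real \<Rightarrow> 'a \<Rightarrow> 'a \<Rightarrow> real" where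
  "scaled_kernel \<Phi> l x y = \<Phi> ((x - y) /\<^sub>R l)"

text \<open>The points \<open>x\<^sub>1, \<dots>, x\<^sub>n\<close> and the entries of \<open>Y\<close> are indexed by a finite type
  \<open>'n\<close>, so \<open>n = CARD('n)\<close>.\<close>

definition kernel_matrix :: "('a \<Rightarrow> 'a \<Rightarrow> real) \<Rightarrow> ('n::finite \<Rightarrow> 'a) \<Rightarrow> real^'n^'n" where
  "kernel_matrix K x = (\<chi> i j. K (x i) (x j))"

definition centred_data :: "('a \<Rightarrow> real) \<Rightarrow> ('n::finite \<Rightarrow> 'a) \<Rightarrow> real^'n \<Rightarrow> real^'n" where
  "centred_data m x Y = (\<chi> i. Y $ i - m (x i))"

definition m_constant :: "('a \<Rightarrow> real) \<Rightarrow> ('n::finite \<Rightarrow> 'a) \<Rightarrow> real^'n \<Rightarrow> bool" where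
  "m_constant m x Y \<longleftrightarrow> (\<exists>c. centred_data m x Y = (\<chi> i. c))"

definition ell ::
  "('a::real_vector \<Rightarrow> real) \<Rightarrow> ('a \<Rightarrow> real) \<Rightarrow> ('n::finite \<Rightarrow> 'a) \<Rightarrow> real^'n \<Rightarrow> real \<Rightarrow> real \<Rightarrow> real" where
  "ell \<Phi> m x Y l s =
     (let K = kernel_matrix (scaled_kernel \<Phi> l) x; Z = centred_data m x Y in
        1 / s\<^sup>2 * (Z \<bullet> (matrix_inv K *v Z)) + ln (det K) + real CARD('n) * ln (s\<^sup>2))"

text \<open>In \<open>sigma_ML\<close> and \<open>lambda_ML_infinite\<close>, \<open>L l s\<close> is the objective as a function of
  \<open>l, s > 0\<close>.  The minimiser in \<open>sigma_ML\<close> exists and is unique for \<open>L = ell \<Phi> m x Y\<close> whenever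
  the kernel matrix is positive definite and the centred data vector is nonzero.\<close>

definition sigma_ML :: "(real \<Rightarrow> real \<Rightarrow> real) \<Rightarrow> real \<Rightarrow> real" where
  "sigma_ML L l = (THE s. is_arg_min (L l) (\<lambda>s. s > 0) s)"

text \<open>\<open>\<lambda>\<^sub>M\<^sub>L = \<infinity>\<close>: along every minimising sequence the scale parameter diverges.  The infimum
  is taken in the extended reals because it may be \<open>-\<infinity>\<close>.\<close>

definition lambda_ML_infinite :: "(real \<Rightarrow> real \<Rightarrow> real) \<Rightarrow> bool" where
  "lambda_ML_infinite L \<longleftrightarrow>
     (\<forall>(lam::nat \<Rightarrow> real) (sig::nat \<Rightarrow> real).
        (\<forall>k. lam k > 0 \<and> sig k > 0) \<and>
        (\<lambda>k. ereal (L (lam k) (sig k))) \<longlonglongrightarrow>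
          (INF (l, s)\<in>{0<..} \<times> {0<..}. ereal (L l s)) \<longrightarrow>
        filterlim lam at_top sequentially)"

end

theory Submission
  imports Defs "HOL-Probability.Characteristic_Functions"
begin

text \<open>
  Let \<open>q(\<lambda>)\<close> be the quadratic form of the inverse kernel matrix \<open>K\<^sub>\<lambda>\<close> at the centred data and \<open>n\<close> the number
  of points.  For fixed \<open>\<lambda>\<close>, minimising over \<open>\<sigma>\<close> is elementary calculus, and the minimum is
  \<open>n + log det K\<^sub>\<lambda> + n log (q(\<lambda>) / n)\<close> (\<open>is_arg_min_profile\<close>).

  As \<open>\<lambda> \<rightarrow> \<infinity>\<close>, the matrix \<open>K\<^sub>\<lambda>\<close> tends to a constant matrix, which is singular because \<open>n \<ge> 2\<close>, so
  \<open>log det K\<^sub>\<lambda> \<rightarrow> -\<infinity>\<close>.  The limit of the profile is therefore \<open>-\<infinity>\<close> once \<open>q\<close> is bounded above, and for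
  constant data this amounts to a bound \<open>\<delta> (\<Sum>i. a\<^sub>i)\<^sup>2 \<le> a\<^sup>T K\<^sub>\<lambda> a\<close> with \<open>\<delta>\<close> independent of \<open>\<lambda>\<close>
  (\<open>inverse_form_of_constant_le\<close>).  By Fourier inversion, \<open>a\<^sup>T K\<^sub>\<lambda> a\<close> is a weighted integral of
  \<open>\<bar>P(\<xi>)\<bar>\<^sup>2\<close>, where \<open>P(\<xi>) = \<Sum>j. a\<^sub>j exp (i \<xi> \<bullet> x\<^sub>j / \<lambda>)\<close> and the weight, a multiple of the Fourier
  transform of \<open>\<Phi>\<close>, is bounded below near the origin.  What is needed is thus that \<open>\<bar>P(0)\<bar>\<^sup>2\<close>, the squared sum of
  the coefficients, is controlled by the mean square of \<open>P\<close> over a ball, uniformly in the frequencies.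
  This is Turan's inequality: the values of an exponential sum with \<open>n\<close> terms at \<open>0, \<xi>, \<dots>, n \<xi>\<close> satisfy
  a linear recurrence with bounded coefficients, so the value at \<open>0\<close> cannot be much larger than the others
  (\<open>turan_sum_power\<close>, \<open>turan_ball\<close>).  The lower bound for \<open>a\<^sup>T K\<^sub>\<lambda> a\<close> itself comes from a
  Gaussian cut-off of the frequencies, which makes all integrals absolutely convergent
  (\<open>integral_fourier_transform_le\<close>).
  The two parts meet in \<open>quadratic_form_ge_square_of_sum\<close>.

  For the second claim it remains to bound the objective below for bounded \<open>\<lambda>\<close>, so that a minimising sequence,
  along which the objective tends to \<open>-\<infinity>\<close>, must leave every interval \<open>(0, b]\<close>.  The form \<open>q\<close> is bounded
  below because the entries of \<open>K\<^sub>\<lambda>\<close> are at most \<open>\<Phi>(0)\<close> (\<open>inverse_form_ge\<close>).  The determinant is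
  positive and continuous in \<open>\<lambda> > 0\<close>, and it tends to \<open>\<Phi>(0)\<^sup>n > 0\<close> as \<open>\<lambda> \<rightarrow> 0\<close>, since \<open>\<Phi>\<close> vanishes at
  infinity: a continuous positive definite function is uniformly continuous, and \<open>\<Phi>\<close> is integrable
  (\<open>det_scaled_kernel_bounded_below\<close>).
\<close>

section \<open>The Fourier transform of the Gaussian\<close>

text \<open>The characteristic function of the standard normal distribution, rescaled by the
  normalising constant of its density.\<close>
lemma fourier_transform_gaussian_real:
  fixes t :: real
  shows "fourier_transform (\<lambda>x. exp (- (norm x)\<^sup>2 / 2)) t
       = complex_of_real (sqrt (2 * pi) * exp (- t\<^sup>2 / 2))"
proof -
  have "(LINT x|lborel. iexp (- t * x) * of_real (std_normal_density x))
      = of_real (exp (- t\<^sup>2 / 2))"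
    using char_std_normal_distribution[unfolded char_def fun_eq_iff, rule_format, of "- t"]
    by (subst (asm) integral_density) (auto simp: scaleR_conv_of_real mult.commute)
  then have "(LINT x|lborel. of_real (1 / sqrt (2 * pi)) * (of_real (exp (- x\<^sup>2 / 2)) * iexp (- t * x)))
      = complex_of_real (exp (- t\<^sup>2 / 2))"
    by (simp add: std_normal_density_def mult_ac)
  then have "of_real (1 / sqrt (2 * pi)) * (LINT x|lborel. of_real (exp (- x\<^sup>2 / 2)) * iexp (- t * x))
      = complex_of_real (exp (- t\<^sup>2 / 2))"
    by (subst (asm) integral_mult_right_zero)
  then show ?thesis
    by (simp add: fourier_transform_def field_simps)
qed

lemma integrable_gaussian_real: "integrable lborel (\<lambda>x::real. exp (- x\<^sup>2 / 2))"
proof -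
  have "integrable lborel (\<lambda>x. sqrt (2 * pi) * std_normal_density x)"
    using integrable_normal_density[of 1 0] by (intro integrable_mult_right) auto
  then show ?thesis by (simp add: std_normal_density_def)
qed

text \<open>Lebesgue measure on a Euclidean space is the image of the product of the one-dimensional
  Lebesgue measures on the coordinates, so Fubini for finite products applies.\<close>
lemma lborel_integral_prod:
  fixes f :: "'a::euclidean_space \<Rightarrow> real \<Rightarrow> 'b::{real_normed_field, banach, second_countable_topology}"
  assumes int: "\<And>b. b \<in> Basis \<Longrightarrow> integrable lborel (f b)"
  shows "integrable lborel (\<lambda>x. \<Prod>b\<in>Basis. f b (x \<bullet> b))"
    and "(LINT x|lborel. (\<Prod>b\<in>Basis. f b (x \<bullet> b))) = (\<Prod>b\<in>Basis. LINT t|lborel. f b t)"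
proof -
  interpret product_sigma_finite "\<lambda>_::'a. lborel :: real measure" ..
  let ?T = "\<lambda>g::'a \<Rightarrow> real. \<Sum>b\<in>Basis. g b *\<^sub>R b"
  have [measurable]: "b \<in> Basis \<Longrightarrow> f b \<in> borel_measurable borel" for b
    using int[of b] by (auto dest: borel_measurable_integrable)
  have m: "(\<lambda>x. \<Prod>b\<in>Basis. f b (x \<bullet> b)) \<in> borel_measurable borel"
    by measurable
  have T: "?T \<in> measurable (\<Pi>\<^sub>M b\<in>Basis. lborel) borel" by measurable
  have eq: "(\<Prod>b\<in>Basis. f b (?T g \<bullet> b)) = (\<Prod>b\<in>Basis. f b (g b))" for g
    by (intro prod.cong) auto
  show "integrable lborel (\<lambda>x. \<Prod>b\<in>Basis. f b (x \<bullet> b))"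
    unfolding lborel_eq[where 'a='a] integrable_distr_eq[OF T m] eq
    by (rule product_integrable_prod) (auto intro: int)
  show "(LINT x|lborel. (\<Prod>b\<in>Basis. f b (x \<bullet> b))) = (\<Prod>b\<in>Basis. LINT t|lborel. f b t)"
    unfolding lborel_eq[where 'a='a] integral_distr[OF T m] eq
    by (rule product_integral_prod) (auto intro: int)
qed

lemma gaussian_eq_prod:
  fixes x :: "'a::euclidean_space"
  shows "exp (- (norm x)\<^sup>2 / 2) = (\<Prod>b\<in>Basis. exp (- (x \<bullet> b)\<^sup>2 / 2))"
proof -
  have "(norm x)\<^sup>2 = (\<Sum>b\<in>Basis. (x \<bullet> b)\<^sup>2)"
    by (subst power2_norm_eq_inner, subst euclidean_inner) (simp add: power2_eq_square)
  then show ?thesis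
    by (simp add: sum_negf sum_divide_distrib flip: exp_sum)
qed

lemma integrable_gaussian:
  "integrable lborel (\<lambda>x::'a::euclidean_space. exp (- (norm x)\<^sup>2 / 2))"
  unfolding gaussian_eq_prod
  by (rule lborel_integral_prod(1)) (rule integrable_gaussian_real)

lemma fourier_transform_gaussian:
  fixes \<xi> :: "'a::euclidean_space"
  shows "fourier_transform (\<lambda>x. exp (- (norm x)\<^sup>2 / 2)) \<xi>
       = of_real (sqrt (2 * pi) ^ DIM('a) * exp (- (norm \<xi>)\<^sup>2 / 2))"
proof -
  let ?f = "\<lambda>(b::'a) t. complex_of_real (exp (- t\<^sup>2 / 2)) * exp (- (\<i> * of_real ((\<xi> \<bullet> b) * t)))"
  have int: "integrable lborel (?f b)" for b
    by (rule Bochner_Integration.integrable_bound[OF integrable_gaussian_real])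
       (auto simp: norm_mult)
  have eq: "complex_of_real (exp (- (norm x)\<^sup>2 / 2)) * exp (- (\<i> * of_real (\<xi> \<bullet> x)))
      = (\<Prod>b\<in>Basis. ?f b (x \<bullet> b))" for x
  proof -
    have "exp (- (\<i> * complex_of_real (\<xi> \<bullet> x)))
        = (\<Prod>b\<in>Basis. exp (- (\<i> * of_real ((\<xi> \<bullet> b) * (x \<bullet> b)))))"
      by (subst euclidean_inner[of \<xi> x])
         (simp add: sum_negf sum_distrib_left flip: exp_sum)
    then show ?thesis
      unfolding prod.distrib gaussian_eq_prod by simp
  qed
  have "fourier_transform (\<lambda>x. exp (- (norm x)\<^sup>2 / 2)) \<xi>
      = (\<Prod>b\<in>Basis. LINT t|lborel. ?f b t)"
    unfolding fourier_transform_def eq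
    by (rule lborel_integral_prod(2)) (rule int)
  also have "\<dots> = (\<Prod>b\<in>Basis. of_real (sqrt (2 * pi) * exp (- (\<xi> \<bullet> b)\<^sup>2 / 2)))"
    using fourier_transform_gaussian_real by (simp add: fourier_transform_def)
  also have "\<dots> = of_real (sqrt (2 * pi) ^ DIM('a) * exp (- (norm \<xi>)\<^sup>2 / 2))"
    unfolding gaussian_eq_prod by (simp add: prod.distrib)
  finally show ?thesis .
qed

text \<open>Substitution of a dilation.  Both halves come from reading Lebesgue measure as a constant
  density over its own image under the dilation.\<close>
lemma lborel_scale:
  fixes f :: "'a::euclidean_space \<Rightarrow> 'b::{banach, second_countable_topology}"
  assumes f: "integrable lborel f" and c: "c > 0"
  shows "integrable lborel (\<lambda>x. f (c *\<^sub>R x))"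
    and "(LINT x|lborel. f x) = c ^ DIM('a) *\<^sub>R (LINT x|lborel. f (c *\<^sub>R x))"
proof -
  have [measurable]: "f \<in> borel_measurable borel"
    using f by (auto dest: borel_measurable_integrable)
  have L: "(lborel :: 'a measure) = density (distr lborel borel (\<lambda>x. c *\<^sub>R x)) (\<lambda>_. ennreal (c ^ DIM('a)))"
    using lborel_affine[of c "0::'a"] c by (simp add: ennreal_power)
  have "integrable (density (distr lborel borel (\<lambda>x::'a. c *\<^sub>R x)) (\<lambda>_. ennreal (c ^ DIM('a)))) f"
    using f L by metis
  then have "integrable lborel (\<lambda>x. c ^ DIM('a) *\<^sub>R f (c *\<^sub>R x))"
    using c by (subst (asm) integrable_density) (auto simp: integrable_distr_eq)
  then show "integrable lborel (\<lambda>x. f (c *\<^sub>R x))"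
    using c integrable_scaleR_right[of "inverse (c ^ DIM('a))" lborel "\<lambda>x. c ^ DIM('a) *\<^sub>R f (c *\<^sub>R x)"]
    by simp
  have "(LINT x|lborel. f x) = (LINT x|density (distr lborel borel (\<lambda>x. c *\<^sub>R x)) (\<lambda>_. ennreal (c ^ DIM('a))). f x)"
    using L by metis
  also have "\<dots> = c ^ DIM('a) *\<^sub>R (LINT x|lborel. f (c *\<^sub>R x))"
    using c by (subst integral_density) (auto simp: integral_distr)
  finally show "(LINT x|lborel. f x) = c ^ DIM('a) *\<^sub>R (LINT x|lborel. f (c *\<^sub>R x))" .
qed

section \<open>Gaussian summability of the Fourier integral\<close>

lemma fourier_transform_measurable [measurable]:
  fixes f :: "'a::euclidean_space \<Rightarrow> real"
  assumes [measurable]: "f \<in> borel_measurable borel"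
  shows "fourier_transform f \<in> borel_measurable borel"
  unfolding fourier_transform_def by measurable

lemma fourier_integrand_integrable:
  fixes f :: "'a::euclidean_space \<Rightarrow> real"
  assumes "integrable lborel f"
  shows "integrable lborel (\<lambda>x. complex_of_real (f x) * exp (- (\<i> * complex_of_real (\<xi> \<bullet> x))))"
proof -
  have [measurable]: "f \<in> borel_measurable borel"
    using assms by (auto dest: borel_measurable_integrable)
  show ?thesis
    by (rule Bochner_Integration.integrable_bound[OF assms]) (auto simp: norm_mult)
qed

lemma norm_fourier_transform_le:
  fixes f :: "'a::euclidean_space \<Rightarrow> real"
  shows "norm (fourier_transform f \<xi>) \<le> (LINT x|lborel. \<bar>f x\<bar>)"
proof -
  have "norm (fourier_transform f \<xi>)
      \<le> (LINT x|lborel. norm (complex_of_real (f x) * exp (- (\<i> * complex_of_real (\<xi> \<bullet> x)))))"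
    unfolding fourier_transform_def by (rule integral_norm_bound)
  then show ?thesis by (simp add: norm_mult)
qed

text \<open>This is the identity \<open>\<integral> g\<^sub>e f^ = \<integral> (g\<^sub>e)^ f\<close> for the dilated Gaussian \<open>g\<^sub>e(\<eta>) = g(e \<eta>)\<close>.
  The Gaussian factor makes the double integral absolutely convergent, so it holds by Fubini, and
  the transform of \<open>g\<^sub>e\<close> is, up to a constant factor, an approximate identity as \<open>e \<rightarrow> 0\<close>; the substitution \<open>x = e u\<close>
  puts the right-hand side in a form that visibly tends to a multiple of \<open>f 0\<close>.\<close>
lemma fourier_gaussian_multiplication:
  fixes f :: "'a::euclidean_space \<Rightarrow> real"
  assumes f: "integrable lborel f" and e: "e > 0"
  shows "(LINT \<eta>|lborel. of_real (exp (- (norm (e *\<^sub>R \<eta>))\<^sup>2 / 2)) * fourier_transform f \<eta>)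
       = of_real (sqrt (2 * pi) ^ DIM('a) *
           (LINT u|lborel. exp (- (norm u)\<^sup>2 / 2) * f (e *\<^sub>R u)))"
    (is "?lhs = _")
proof -
  let ?g = "\<lambda>u::'a. exp (- (norm u)\<^sup>2 / 2)"
  let ?E = "\<lambda>(\<eta>::'a) x. exp (- (\<i> * complex_of_real (\<eta> \<bullet> x)))"
  let ?F = "\<lambda>\<eta> x. complex_of_real (?g (e *\<^sub>R \<eta>)) * (of_real (f x) * ?E \<eta> x)"
  let ?S = "sqrt (2 * pi) ^ DIM('a)"
  have [measurable]: "f \<in> borel_measurable borel"
    using f by (auto dest: borel_measurable_integrable)
  have ge: "integrable lborel (\<lambda>\<eta>::'a. ?g (e *\<^sub>R \<eta>))"
    by (rule lborel_scale(1)[OF integrable_gaussian e])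
  have int: "integrable (lborel \<Otimes>\<^sub>M lborel) (\<lambda>(\<eta>, x). ?F \<eta> x)"
  proof (rule lborel_pair.Fubini_integrable)
    show "integrable lborel (\<lambda>\<eta>. LINT x|lborel. norm (case (\<eta>, x) of (\<eta>, x) \<Rightarrow> ?F \<eta> x))"
      using ge by (simp add: norm_mult)
    show "AE \<eta> in lborel. integrable lborel (\<lambda>x. case (\<eta>, x) of (\<eta>, x) \<Rightarrow> ?F \<eta> x)"
      using fourier_integrand_integrable[OF f] by auto
  qed measurable
  have inner: "(LINT \<eta>|lborel. ?F \<eta> x)
      = of_real (f x * (?S * ?g (x /\<^sub>R e) / e ^ DIM('a)))" for x
  proof -
    let ?h = "\<lambda>\<zeta>. complex_of_real (?g \<zeta>) * ?E (x /\<^sub>R e) \<zeta>"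
    have "?h (e *\<^sub>R \<eta>) = of_real (?g (e *\<^sub>R \<eta>)) * ?E \<eta> x" for \<eta>
    proof -
      have "(x /\<^sub>R e) \<bullet> (e *\<^sub>R \<eta>) = \<eta> \<bullet> x"
        using e by (simp add: inner_commute)
      then show ?thesis by (simp only:)
    qed
    then have "(LINT \<eta>|lborel. of_real (?g (e *\<^sub>R \<eta>)) * ?E \<eta> x)
        = (LINT \<zeta>|lborel. ?h \<zeta>) / e ^ DIM('a)"
      using lborel_scale(2)[OF fourier_integrand_integrable[OF integrable_gaussian] e, of "x /\<^sub>R e"] e
      by (simp add: scaleR_conv_of_real)
    also have "(LINT \<zeta>|lborel. ?h \<zeta>) = of_real (?S * ?g (x /\<^sub>R e))"
      using fourier_transform_gaussian[of "x /\<^sub>R e"] unfolding fourier_transform_def .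
    finally have "of_real (f x) * (LINT \<eta>|lborel. of_real (?g (e *\<^sub>R \<eta>)) * ?E \<eta> x)
      = of_real (f x * (?S * ?g (x /\<^sub>R e) / e ^ DIM('a)))"
      by simp
    then show ?thesis
      by (subst (asm) integral_mult_right_zero[symmetric]) (simp add: mult_ac)
  qed
  have fg: "integrable lborel (\<lambda>x. f x * ?g (x /\<^sub>R e))"
    by (rule Bochner_Integration.integrable_bound[OF f])
       (auto simp: abs_mult intro!: mult_left_le)
  have "?lhs = (LINT \<eta>|lborel. LINT x|lborel. ?F \<eta> x)"
    unfolding fourier_transform_def by (subst integral_mult_right_zero) (rule refl)
  also have "\<dots> = (LINT x|lborel. LINT \<eta>|lborel. ?F \<eta> x)"
    using lborel_pair.Fubini_integral[OF int] by simp
  also have "\<dots> = of_real (LINT x|lborel. f x * (?S * ?g (x /\<^sub>R e) / e ^ DIM('a)))"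
    unfolding inner by (rule integral_complex_of_real)
  also have "(LINT x|lborel. f x * (?S * ?g (x /\<^sub>R e) / e ^ DIM('a)))
      = ?S / e ^ DIM('a) * (LINT x|lborel. f x * ?g (x /\<^sub>R e))"
    by (subst integral_mult_right_zero[symmetric]) (simp add: mult_ac)
  also have "(LINT x|lborel. f x * ?g (x /\<^sub>R e)) = e ^ DIM('a) * (LINT u|lborel. ?g u * f (e *\<^sub>R u))"
    using lborel_scale(2)[OF fg e] e by (simp add: mult.commute)
  finally show ?thesis using e by simp
qed

text \<open>One half of the inversion formula at the origin: let \<open>e \<rightarrow> 0\<close> in the multiplication formula.  As the integrand on the frequency side
  is nonnegative, discarding the frequencies outside \<open>B\<close> only decreases the integral.\<close>
lemma integral_fourier_transform_le:
  fixes f :: "'a::euclidean_space \<Rightarrow> real"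
  assumes cont: "continuous_on UNIV f" and f: "integrable lborel f"
    and bound: "\<And>x. \<bar>f x\<bar> \<le> M"
    and nonneg: "\<And>\<xi>. 0 \<le> Re (fourier_transform f \<xi>)"
    and B: "B \<in> fmeasurable lborel"
  shows "(LINT \<xi>|lborel. indicator B \<xi> * Re (fourier_transform f \<xi>)) \<le> (2 * pi) ^ DIM('a) * f 0"
proof -
  let ?g = "\<lambda>u::'a. exp (- (norm u)\<^sup>2 / 2)"
  let ?S = "sqrt (2 * pi) ^ DIM('a)"
  define e where "e k = inverse (real (Suc k))" for k
  have e: "e k > 0" for k by (simp add: e_def)
  have e0: "e \<longlonglongrightarrow> 0"
    unfolding e_def by (rule LIMSEQ_inverse_real_of_nat)
  have [measurable]: "f \<in> borel_measurable borel" "B \<in> sets borel"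
    using f B by (auto dest: borel_measurable_integrable)
  have "M \<ge> 0" using bound[of 0] by linarith
  have scaled: "(\<lambda>k. e k *\<^sub>R u) \<longlonglongrightarrow> 0" for u :: 'a
    using tendsto_scaleR[OF e0 tendsto_const] by simp
  have gauss_int: "(LINT u|lborel. ?g u) = ?S"
    using fourier_transform_gaussian[of "0::'a"] unfolding fourier_transform_def
    by (simp del: of_real_power of_real_exp add: integral_complex_of_real of_real_eq_iff)

  have "(\<lambda>k. LINT u|lborel. ?g u * f (e k *\<^sub>R u)) \<longlonglongrightarrow> (LINT u|lborel. ?g u * f 0)"
  proof (rule integral_dominated_convergence[where w = "\<lambda>u. ?g u * M"])
    show "integrable lborel (\<lambda>u. ?g u * M)"
      using integrable_gaussian by (rule integrable_mult_left)
    show "AE u in lborel. (\<lambda>k. ?g u * f (e k *\<^sub>R u)) \<longlonglongrightarrow> ?g u * f 0"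
      using cont scaled
      by (intro always_eventually allI tendsto_intros)
         (auto simp: continuous_on_eq_continuous_at isCont_def intro: isCont_tendsto_compose)
    show "AE u in lborel. norm (?g u * f (e k *\<^sub>R u)) \<le> ?g u * M" for k
      using bound by (auto simp: abs_mult)
  qed auto
  then have lim1: "(\<lambda>k. ?S * (LINT u|lborel. ?g u * f (e k *\<^sub>R u))) \<longlonglongrightarrow> ?S * (?S * f 0)"
    by (intro tendsto_mult tendsto_const) (simp only: integral_mult_left_zero gauss_int)

  have lim2: "(\<lambda>k. LINT \<xi>|lborel. indicator B \<xi> * (?g (e k *\<^sub>R \<xi>) * Re (fourier_transform f \<xi>)))
      \<longlonglongrightarrow> (LINT \<xi>|lborel. indicator B \<xi> * Re (fourier_transform f \<xi>))"
  proof (rule integral_dominated_convergence[where w = "\<lambda>\<xi>. indicator B \<xi> * (LINT x|lborel. \<bar>f x\<bar>)"])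
    show "integrable lborel (\<lambda>\<xi>. indicator B \<xi> * (LINT x|lborel. \<bar>f x\<bar>))"
      using B by (intro integrable_mult_left) (auto simp: fmeasurable_def less_top)
    have "(\<lambda>k. ?g (e k *\<^sub>R \<xi>)) \<longlonglongrightarrow> 1" for \<xi>
      using tendsto_exp[OF tendsto_divide[OF tendsto_minus[OF tendsto_power[OF tendsto_norm[OF scaled[of \<xi>]], of 2]] tendsto_const, of 2]]
      by simp
    then have "(\<lambda>k. indicator B \<xi> * (?g (e k *\<^sub>R \<xi>) * Re (fourier_transform f \<xi>)))
       \<longlonglongrightarrow> indicator B \<xi> * (1 * Re (fourier_transform f \<xi>))" for \<xi>
      by (intro tendsto_intros)
    then show "AE \<xi> in lborel. (\<lambda>k. indicator B \<xi> * (?g (e k *\<^sub>R \<xi>) * Re (fourier_transform f \<xi>)))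
       \<longlonglongrightarrow> indicator B \<xi> * Re (fourier_transform f \<xi>)" by simp
    have le: "\<bar>Re (fourier_transform f \<xi>)\<bar> \<le> (LINT x|lborel. \<bar>f x\<bar>)" for \<xi>
      using norm_fourier_transform_le[of f \<xi>] abs_Re_le_cmod[of "fourier_transform f \<xi>"] by linarith
    have "?g \<eta> * \<bar>Re (fourier_transform f \<xi>)\<bar> \<le> 1 * (LINT x|lborel. \<bar>f x\<bar>)" for \<eta> \<xi>
      using le[of \<xi>] by (intro mult_mono) auto
    then show "AE \<xi> in lborel. norm (indicator B \<xi> * (?g (e k *\<^sub>R \<xi>) * Re (fourier_transform f \<xi>)))
        \<le> indicator B \<xi> * (LINT x|lborel. \<bar>f x\<bar>)" for k
      by (intro AE_I2) (auto simp: abs_mult indicator_def simp del: norm_scaleR)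
  qed measurable

  have "(LINT \<xi>|lborel. indicator B \<xi> * (?g (e k *\<^sub>R \<xi>) * Re (fourier_transform f \<xi>)))
      \<le> ?S * (LINT u|lborel. ?g u * f (e k *\<^sub>R u))" for k
  proof -
    let ?G = "\<lambda>\<xi>. complex_of_real (?g (e k *\<^sub>R \<xi>)) * fourier_transform f \<xi>"
    have ge: "integrable lborel (\<lambda>\<eta>::'a. ?g (e k *\<^sub>R \<eta>) * (LINT x|lborel. \<bar>f x\<bar>))"
      by (intro integrable_mult_left lborel_scale(1)[OF integrable_gaussian e])
    have G: "integrable lborel ?G"
      using norm_fourier_transform_le[of f]
      by (intro Bochner_Integration.integrable_bound[OF ge])
         (auto simp: norm_mult intro!: AE_I2 mult_left_mono)
    have RG: "integrable lborel (\<lambda>\<xi>. ?g (e k *\<^sub>R \<xi>) * Re (fourier_transform f \<xi>))"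
      using integrable_Re[OF G] by simp
    have "(LINT \<xi>|lborel. indicator B \<xi> * (?g (e k *\<^sub>R \<xi>) * Re (fourier_transform f \<xi>)))
        \<le> (LINT \<xi>|lborel. ?g (e k *\<^sub>R \<xi>) * Re (fourier_transform f \<xi>))"
      using nonneg
      by (intro integral_mono RG Bochner_Integration.integrable_bound[OF RG])
         (auto simp: indicator_def abs_mult intro!: AE_I2)
    also have "\<dots> = Re (LINT \<xi>|lborel. ?G \<xi>)"
      using integral_Re[OF G] by simp
    also have "\<dots> = ?S * (LINT u|lborel. ?g u * f (e k *\<^sub>R u))"
      unfolding fourier_gaussian_multiplication[OF f e] by (rule Re_complex_of_real)
    finally show ?thesis .
  qed
  then have "(LINT \<xi>|lborel. indicator B \<xi> * Re (fourier_transform f \<xi>)) \<le> ?S * (?S * f 0)"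
    by (intro LIMSEQ_le[OF lim2 lim1]) blast
  also have "?S * (?S * f 0) = (2 * pi) ^ DIM('a) * f 0"
  proof -
    have "?S * ?S = (2 * pi) ^ DIM('a)"
      by (subst power_mult_distrib[symmetric]) simp
    then show ?thesis by (simp only: mult.assoc[symmetric])
  qed
  finally show ?thesis .
qed

section \<open>Turan's inequality for exponential sums\<close>

text \<open>The polynomial is \<open>\<Prod>i\<in>I. (1 - X / w i)\<close>, and \<open>1 / w i\<close> is the conjugate of \<open>w i\<close> on the unit
  circle.  Each factor at most doubles the largest coefficient.\<close>
lemma poly_vanishing_on_unit_circle:
  fixes w :: "'i \<Rightarrow> complex"
  assumes "finite I" "\<And>i. i \<in> I \<Longrightarrow> norm (w i) = 1"
  shows "\<exists>p. coeff p 0 = 1 \<and> degree p \<le> card I \<and> (\<forall>k. norm (coeff p k) \<le> 2 ^ card I)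
           \<and> (\<forall>i\<in>I. poly p (w i) = 0)"
  using assms
proof (induction I)
  case empty
  show ?case by (intro exI[of _ 1]) (auto simp: coeff_1)
next
  case (insert j I)
  then obtain p where p: "coeff p 0 = 1" "degree p \<le> card I" "\<And>k. norm (coeff p k) \<le> 2 ^ card I"
      "\<And>i. i \<in> I \<Longrightarrow> poly p (w i) = 0"
    by auto
  let ?q = "[:1, - cnj (w j):] * p"
  have q: "?q = p - pCons 0 (smult (cnj (w j)) p)" by simp
  have wj: "w j * cnj (w j) = 1" "norm (w j) = 1"
    using insert.prems by (auto simp: complex_norm_square[symmetric])
  have card: "card (insert j I) = Suc (card I)" using insert by simp
  have "coeff ?q 0 = 1" using p(1) unfolding q by simp
  moreover have "degree ?q \<le> card (insert j I)"
  proof -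
    have "degree ?q \<le> degree [:1, - cnj (w j):] + degree p" by (rule degree_mult_le)
    then show ?thesis using p(2) card by (simp split: if_splits)
  qed
  moreover have "norm (coeff ?q k) \<le> 2 ^ card (insert j I)" for k
  proof -
    have "norm (coeff ?q k) \<le> norm (coeff p k) + norm (coeff (pCons 0 (smult (cnj (w j)) p)) k)"
      unfolding q coeff_diff by (rule norm_triangle_ineq4)
    also have "norm (coeff (pCons 0 (smult (cnj (w j)) p)) k) \<le> 2 ^ card I"
      using p(3) wj(2) by (cases k) (auto simp: norm_mult)
    finally show ?thesis using p(3)[of k] unfolding card by simp
  qed
  moreover have "poly ?q (w i) = 0" if "i \<in> insert j I" for i
    using that p(4) wj(1) by auto
  ultimately show ?case by blast
qed

text \<open>Turan's first main theorem for frequencies on the unit circle.  For the polynomial \<open>p\<close> of the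
  previous lemma, \<open>\<Sum>i. b i * p (w i) = 0\<close>; expanding \<open>p\<close> writes \<open>\<Sum>i. b i\<close>, the power sum of exponent
  \<open>0\<close>, as a combination of the power sums with exponents \<open>1, \<dots>, n\<close> whose coefficients do not exceed
  \<open>2 ^ n\<close>.  The constant does not depend on the nodes \<open>w i\<close>; they may be arbitrarily close together.\<close>
lemma turan_sum_power:
  fixes w b :: "'i \<Rightarrow> complex"
  assumes I: "finite I" "\<And>i. i \<in> I \<Longrightarrow> norm (w i) = 1"
  defines "n \<equiv> card I"
  shows "(norm (\<Sum>i\<in>I. b i))\<^sup>2 \<le> 4 ^ n * n * (\<Sum>k=1..n. (norm (\<Sum>i\<in>I. b i * w i ^ k))\<^sup>2)"
proof -
  let ?P = "\<lambda>k. \<Sum>i\<in>I. b i * w i ^ k"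
  obtain p where p: "coeff p 0 = 1" "degree p \<le> n" "\<And>k. norm (coeff p k) \<le> 2 ^ n"
      "\<And>i. i \<in> I \<Longrightarrow> poly p (w i) = 0"
    using poly_vanishing_on_unit_circle[OF I(1), of w, OF I(2)] unfolding n_def by blast
  have "0 = (\<Sum>i\<in>I. b i * poly p (w i))" using p(4) by simp
  also have "\<dots> = (\<Sum>i\<in>I. \<Sum>k\<le>n. coeff p k * (b i * w i ^ k))"
  proof -
    have "poly p x = (\<Sum>k\<le>n. coeff p k * x ^ k)" for x
      unfolding poly_altdef using p(2) by (intro sum.mono_neutral_left) (auto simp: coeff_eq_0)
    then show ?thesis by (simp add: sum_distrib_left mult_ac)
  qed
  also have "\<dots> = (\<Sum>k\<le>n. coeff p k * ?P k)"
    by (subst sum.swap) (simp add: sum_distrib_left)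
  also have "\<dots> = ?P 0 + (\<Sum>k=1..n. coeff p k * ?P k)"
  proof -
    have "{..n} = insert 0 {1..n}" by auto
    then show ?thesis using p(1) by simp
  qed
  finally have "?P 0 = - (\<Sum>k=1..n. coeff p k * ?P k)"
    by (simp add: eq_neg_iff_add_eq_0)
  then have "norm (?P 0) \<le> (\<Sum>k=1..n. norm (coeff p k * ?P k))"
    by (simp only: norm_minus_cancel norm_sum)
  also have "\<dots> \<le> (\<Sum>k=1..n. 2 ^ n * norm (?P k))"
    by (intro sum_mono) (auto simp: norm_mult intro!: mult_right_mono p(3))
  finally have "norm (?P 0) \<le> 2 ^ n * (\<Sum>k=1..n. norm (?P k))"
    by (simp add: sum_distrib_left)
  then have "(norm (?P 0))\<^sup>2 \<le> (2 ^ n * (\<Sum>k=1..n. norm (?P k)))\<^sup>2"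
    by (intro power_mono) auto
  also have "\<dots> = 4 ^ n * (\<Sum>k=1..n. norm (?P k))\<^sup>2"
    by (simp add: power_mult_distrib power_mult[symmetric] mult.commute[of n 2] power_mult[of _ 2 n])
  also have "\<dots> \<le> 4 ^ n * ((\<Sum>k=1..n. (norm (?P k))\<^sup>2) * card {1..n})"
    by (intro mult_left_mono sum_squared_le_sum_of_squares) auto
  finally show ?thesis by (simp add: mult_ac)
qed

definition exp_sum_at :: "'i set \<Rightarrow> ('i \<Rightarrow> 'a::euclidean_space) \<Rightarrow> ('i \<Rightarrow> real) \<Rightarrow> 'a \<Rightarrow> complex" where
  "exp_sum_at I z a \<xi> = (\<Sum>i\<in>I. of_real (a i) * cis (\<xi> \<bullet> z i))"

lemma continuous_exp_sum_at [continuous_intros]: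
  "continuous_on UNIV (exp_sum_at I z a)"
  unfolding exp_sum_at_def by (intro continuous_intros)

text \<open>An exponential sum cannot be large at the origin and small in mean square near the origin, with a
  constant depending only on the number of frequencies.  On the ray through \<open>\<xi>\<close>, the values at
  \<open>0, \<xi>, 2 \<xi>, \<dots>\<close> are power sums of the unimodular numbers \<open>cis (\<xi> \<bullet> z i)\<close>, so Turan's inequality applies for
  each \<open>\<xi>\<close>; integrate over the ball and substitute \<open>\<eta> = k \<xi>\<close> in the \<open>k\<close>-th term.\<close>
lemma turan_ball:
  fixes z :: "'i \<Rightarrow> 'a::euclidean_space"
  assumes "finite I"
  defines "n \<equiv> card I"
  shows "(\<Sum>i\<in>I. a i)\<^sup>2 * measure lborel (cball (0::'a) r)
       \<le> 4 ^ n * (real n)\<^sup>2 * (LINT \<xi>|lborel. indicator (cball 0 (n * r)) \<xi> * (norm (exp_sum_at I z a \<xi>))\<^sup>2)"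
proof -
  let ?P = "exp_sum_at I z a"
  let ?B = "cball (0::'a) r" and ?nB = "cball (0::'a) (n * r)"
  define J where "J = (LINT \<xi>|lborel. indicator ?nB \<xi> * (norm (?P \<xi>))\<^sup>2)"
  have cont: "continuous_on UNIV (\<lambda>\<xi>. (norm (?P (c *\<^sub>R \<xi>)))\<^sup>2)" for c
    by (intro continuous_intros continuous_on_compose2[OF continuous_exp_sum_at]) auto
  have int: "integrable lborel (\<lambda>\<xi>. indicator (cball 0 s) \<xi> * (norm (?P (c *\<^sub>R \<xi>)))\<^sup>2)" for s c
    using borel_integrable_compact[of "cball 0 s" "\<lambda>\<xi>. (norm (?P (c *\<^sub>R \<xi>)))\<^sup>2"] continuous_on_subset[OF cont]
    by (auto simp: indicator_def if_distrib cong: if_cong)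
  have Bfin: "integrable lborel (indicator ?B :: 'a \<Rightarrow> real)"
    using emeasure_lborel_cball_finite[of 0 r] by (auto simp: less_top)
  have dilate: "(LINT \<xi>|lborel. indicator ?B \<xi> * (norm (?P (real k *\<^sub>R \<xi>)))\<^sup>2) \<le> J"
    if k: "k \<in> {1..n}" for k
  proof -
    let ?h = "\<lambda>\<xi>. indicator ?nB \<xi> * (norm (?P \<xi>))\<^sup>2"
    have h: "integrable lborel ?h" using int[of "n * r" 1] by simp
    have le: "norm (real k *\<^sub>R \<xi>) \<le> n * r" if "norm \<xi> \<le> r" for \<xi> :: 'a
      using k that by (auto intro!: mult_mono intro: order_trans[OF norm_ge_zero])
    have "(LINT \<xi>|lborel. indicator ?B \<xi> * (norm (?P (real k *\<^sub>R \<xi>)))\<^sup>2)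
        \<le> (LINT \<xi>|lborel. ?h (real k *\<^sub>R \<xi>))"
      using k le by (intro integral_mono int lborel_scale(1)[OF h]) (auto simp: indicator_def)
    also have "\<dots> \<le> real k ^ DIM('a) * (LINT \<xi>|lborel. ?h (real k *\<^sub>R \<xi>))"
    proof -
      have "1 \<le> real k ^ DIM('a)" using k by (intro one_le_power) simp
      moreover have "0 \<le> (LINT \<xi>|lborel. ?h (real k *\<^sub>R \<xi>))" by (intro Bochner_Integration.integral_nonneg) simp
      ultimately show ?thesis
        using mult_right_mono[of 1 "real k ^ DIM('a)" "LINT \<xi>|lborel. ?h (real k *\<^sub>R \<xi>)"]
        by (simp only: mult_1)
    qed
    also have "\<dots> = J"
      using lborel_scale(2)[OF h, of "real k"] k unfolding J_def by simp
    finally show ?thesis .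
  qed
  have pointwise: "(\<Sum>i\<in>I. a i)\<^sup>2 \<le> 4 ^ n * n * (\<Sum>k=1..n. (norm (?P (real k *\<^sub>R \<xi>)))\<^sup>2)" for \<xi>
    using turan_sum_power[OF \<open>finite I\<close>, of "\<lambda>i. cis (\<xi> \<bullet> z i)" "\<lambda>i. of_real (a i)"]
    by (simp add: exp_sum_at_def Complex.DeMoivre n_def flip: of_real_sum)
  have "(\<Sum>i\<in>I. a i)\<^sup>2 * measure lborel ?B = (LINT \<xi>|lborel. indicator ?B \<xi> * (\<Sum>i\<in>I. a i)\<^sup>2)"
    by simp
  also have "\<dots> \<le> (LINT \<xi>|lborel. 4 ^ n * n * (\<Sum>k=1..n. indicator ?B \<xi> * (norm (?P (real k *\<^sub>R \<xi>)))\<^sup>2))"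
    using pointwise
    by (intro integral_mono integrable_mult_right integrable_mult_left Bfin Bochner_Integration.integrable_sum int)
       (auto simp: indicator_def)
  also have "\<dots> = 4 ^ n * n * (\<Sum>k=1..n. LINT \<xi>|lborel. indicator ?B \<xi> * (norm (?P (real k *\<^sub>R \<xi>)))\<^sup>2)"
    by (subst integral_mult_right_zero, subst Bochner_Integration.integral_sum) (use int in auto)
  also have "\<dots> \<le> 4 ^ n * n * (\<Sum>k=1..n. J)"
    by (intro mult_left_mono sum_mono dilate) auto
  finally show ?thesis unfolding J_def by (simp add: power2_eq_square mult_ac)
qed

section \<open>Coercivity of the quadratic form on constants\<close>

lemma fourier_transform_translate:
  fixes f :: "'a::euclidean_space \<Rightarrow> real"
  assumes f: "integrable lborel f"
  shows "integrable lborel (\<lambda>v. f (t + v))"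
    and "fourier_transform (\<lambda>v. f (t + v)) \<xi> = cis (\<xi> \<bullet> t) * fourier_transform f \<xi>"
proof -
  have [measurable]: "f \<in> borel_measurable borel"
    using f by (auto dest: borel_measurable_integrable)
  have "integrable (distr lborel borel ((+) t)) f" using f by (simp add: lborel_distr_plus)
  then show "integrable lborel (\<lambda>v. f (t + v))" by (subst (asm) integrable_distr_eq) auto
  let ?E = "\<lambda>x. exp (- (\<i> * complex_of_real (\<xi> \<bullet> x)))"
  have E: "?E v = cis (\<xi> \<bullet> t) * ?E (t + v)" for v
    by (simp add: cis_conv_exp inner_add_right algebra_simps flip: exp_add)
  have "fourier_transform (\<lambda>v. f (t + v)) \<xi>
      = (LINT v|lborel. cis (\<xi> \<bullet> t) * (of_real (f (t + v)) * ?E (t + v)))"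
    unfolding fourier_transform_def by (intro Bochner_Integration.integral_cong refl) (subst E, simp only: mult_ac)
  also have "\<dots> = cis (\<xi> \<bullet> t) * (LINT v|lborel. of_real (f (t + v)) * ?E (t + v))"
    by (rule integral_mult_right_zero)
  also have "(LINT v|lborel. of_real (f (t + v)) * ?E (t + v))
      = (LINT v|distr lborel borel ((+) t). of_real (f v) * ?E v)"
    by (subst integral_distr) auto
  finally show "fourier_transform (\<lambda>v. f (t + v)) \<xi> = cis (\<xi> \<bullet> t) * fourier_transform f \<xi>"
    by (simp add: lborel_distr_plus fourier_transform_def)
qed

text \<open>The key estimate.  The function \<open>f v = \<Sum>i j. a i * a j * \<Phi> (z i - z j + v)\<close> has the transform
  \<open>\<bar>P\<bar>\<^sup>2\<close> times that of \<open>\<Phi>\<close>, where \<open>P\<close> is the exponential sum with frequencies \<open>z i\<close> and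
  coefficients \<open>a i\<close>.  Therefore \<open>f 0\<close> dominates the integral of \<open>\<bar>P\<bar>\<^sup>2\<close> over a ball on which the
  transform of \<open>\<Phi>\<close> is at least \<open>c\<close>, and Turan's inequality compares that integral with
  \<open>\<bar>P 0\<bar>\<^sup>2\<close>, the squared sum of the coefficients.  The order of the quantifiers is what matters:
  \<open>\<delta>\<close> does not depend on the points, so it survives rescaling them.\<close>
lemma quadratic_form_ge_square_of_sum:
  fixes \<Phi> :: "'a::euclidean_space \<Rightarrow> real"
  assumes cont: "continuous_on UNIV \<Phi>" and int: "integrable lborel \<Phi>"
    and bound: "\<And>x. \<bar>\<Phi> x\<bar> \<le> M"
    and nonneg: "\<And>\<xi>. 0 \<le> Re (fourier_transform \<Phi> \<xi>)"
    and lower: "\<And>\<xi>. norm \<xi> \<le> real n \<Longrightarrow> c \<le> Re (fourier_transform \<Phi> \<xi>)"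
    and "c > 0" "n > 0"
  shows "\<exists>\<delta>>0. \<forall>I (z :: 'i \<Rightarrow> 'a) a. finite I \<and> card I = n \<longrightarrow>
           \<delta> * (\<Sum>i\<in>I. a i)\<^sup>2 \<le> (\<Sum>i\<in>I. \<Sum>j\<in>I. a i * a j * \<Phi> (z i - z j))"
proof -
  define V where "V = measure lborel (cball (0::'a) 1)"
  define \<delta> where "\<delta> = c * V / (4 ^ n * (real n)\<^sup>2 * (2 * pi) ^ DIM('a))"
  have "V > 0" unfolding V_def
    using content_cball_pos[of 1 "0::'a"] by simp
  then have "\<delta> > 0" using \<open>c > 0\<close> \<open>n > 0\<close> by (simp add: \<delta>_def)
  moreover have "\<delta> * (\<Sum>i\<in>I. a i)\<^sup>2 \<le> (\<Sum>i\<in>I. \<Sum>j\<in>I. a i * a j * \<Phi> (z i - z j))"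
    if I: "finite I" "card I = n" for I and z :: "'i \<Rightarrow> 'a" and a
  proof -
    define f where "f v = (\<Sum>i\<in>I. \<Sum>j\<in>I. a i * a j * \<Phi> (z i - z j + v))" for v
    let ?P = "exp_sum_at I z a" and ?B = "cball (0::'a) n"
    have f_cont: "continuous_on UNIV f"
      unfolding f_def by (intro continuous_intros continuous_on_compose2[OF cont]) auto
    have f_int: "integrable lborel f"
      unfolding f_def
      by (intro Bochner_Integration.integrable_sum integrable_mult_right fourier_transform_translate(1) int)
    have f_bound: "\<bar>f v\<bar> \<le> (\<Sum>i\<in>I. \<Sum>j\<in>I. \<bar>a i * a j\<bar> * M)" for v
      unfolding f_def
      by (intro order_trans[OF sum_abs] sum_mono) (simp add: abs_mult mult_left_mono bound)
    have f_hat: "fourier_transform f \<xi> = of_real ((norm (?P \<xi>))\<^sup>2) * fourier_transform \<Phi> \<xi>" for \<xi>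
    proof -
      have "fourier_transform f \<xi>
          = (LINT v|lborel. (\<Sum>i\<in>I. \<Sum>j\<in>I. of_real (a i * a j) *
               (of_real (\<Phi> (z i - z j + v)) * exp (- (\<i> * complex_of_real (\<xi> \<bullet> v))))))"
        unfolding fourier_transform_def f_def by (simp add: sum_distrib_left sum_distrib_right mult_ac)
      also have "\<dots> = (\<Sum>i\<in>I. \<Sum>j\<in>I. of_real (a i * a j) * fourier_transform (\<lambda>v. \<Phi> (z i - z j + v)) \<xi>)"
        unfolding fourier_transform_def
        by (simp add: Bochner_Integration.integral_sum fourier_integrand_integrable fourier_transform_translate(1)[OF int]
             del: of_real_mult)
      also have "\<dots> = (\<Sum>i\<in>I. \<Sum>j\<in>I. of_real (a i * a j) * (cis (\<xi> \<bullet> (z i - z j)) * fourier_transform \<Phi> \<xi>))"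
        by (simp only: fourier_transform_translate(2)[OF int])
      also have "\<dots> = (?P \<xi> * cnj (?P \<xi>)) * fourier_transform \<Phi> \<xi>"
      proof -
        have "?P \<xi> * cnj (?P \<xi>) = (\<Sum>i\<in>I. \<Sum>j\<in>I. of_real (a i * a j) * cis (\<xi> \<bullet> (z i - z j)))"
          unfolding exp_sum_at_def cnj_sum sum_product
          by (intro sum.cong refl) (simp add: inner_diff_right cis_cnj cis_mult mult_ac)
        then show ?thesis by (simp only: sum_distrib_right mult.assoc)
      qed
      finally show ?thesis by (simp only: complex_norm_square)
    qed
    have f_hat_Re: "Re (fourier_transform f \<xi>) = (norm (?P \<xi>))\<^sup>2 * Re (fourier_transform \<Phi> \<xi>)" for \<xi>
      unfolding f_hat by (simp del: of_real_power)
    have B: "?B \<in> fmeasurable lborel"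
      using emeasure_lborel_cball_finite by (auto simp: fmeasurable_def)
    have cont_P: "continuous_on ?B (\<lambda>\<xi>. (norm (?P \<xi>))\<^sup>2)"
      by (intro continuous_intros continuous_on_subset[OF continuous_exp_sum_at]) auto
    have int_P: "integrable lborel (\<lambda>\<xi>. indicator ?B \<xi> * (norm (?P \<xi>))\<^sup>2)"
      using borel_integrable_compact[OF _ cont_P] by (auto simp: indicator_def if_distrib cong: if_cong)
    have [measurable]: "f \<in> borel_measurable borel" "?B \<in> sets borel"
      using f_int by (auto dest: borel_measurable_integrable)
    have int_B: "integrable lborel (\<lambda>\<xi>. indicator ?B \<xi> * (LINT x|lborel. \<bar>f x\<bar>))"
      using B by (intro integrable_mult_left) (auto simp: fmeasurable_def less_top)
    have int_f_hat: "integrable lborel (\<lambda>\<xi>. indicator ?B \<xi> * Re (fourier_transform f \<xi>))"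
    proof (rule Bochner_Integration.integrable_bound[OF int_B])
      show "AE \<xi> in lborel. norm (indicator ?B \<xi> * Re (fourier_transform f \<xi>))
          \<le> norm (indicator ?B \<xi> * (LINT x|lborel. \<bar>f x\<bar>))"
        using norm_fourier_transform_le[of f] abs_Re_le_cmod
        by (intro AE_I2) (auto simp: indicator_def abs_mult intro: order_trans)
    qed measurable
    have "c * (LINT \<xi>|lborel. indicator ?B \<xi> * (norm (?P \<xi>))\<^sup>2)
        = (LINT \<xi>|lborel. indicator ?B \<xi> * ((norm (?P \<xi>))\<^sup>2 * c))"
      by (subst integral_mult_right_zero[symmetric]) (simp add: mult_ac)
    also have "\<dots> \<le> (LINT \<xi>|lborel. indicator ?B \<xi> * Re (fourier_transform f \<xi>))"
      using integrable_mult_left[OF int_P, of c] lower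
      by (intro integral_mono int_f_hat) (auto simp: f_hat_Re indicator_def mult.assoc intro!: mult_left_mono)
    also have "\<dots> \<le> (2 * pi) ^ DIM('a) * f 0"
      using nonneg by (intro integral_fourier_transform_le[OF f_cont f_int f_bound _ B]) (simp add: f_hat_Re)
    finally have *: "c * (LINT \<xi>|lborel. indicator ?B \<xi> * (norm (?P \<xi>))\<^sup>2) \<le> (2 * pi) ^ DIM('a) * f 0" .
    have "c * ((\<Sum>i\<in>I. a i)\<^sup>2 * V)
        \<le> c * (4 ^ n * (real n)\<^sup>2 * (LINT \<xi>|lborel. indicator ?B \<xi> * (norm (?P \<xi>))\<^sup>2))"
      using turan_ball[OF I(1), of a 1 z] \<open>c > 0\<close> unfolding I(2) V_def
      by (intro mult_left_mono) auto
    also have "\<dots> \<le> 4 ^ n * (real n)\<^sup>2 * ((2 * pi) ^ DIM('a) * f 0)"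
      using mult_left_mono[OF *, of "4 ^ n * (real n)\<^sup>2"] by (simp add: mult_ac)
    finally have "\<delta> * (\<Sum>i\<in>I. a i)\<^sup>2 \<le> f 0"
      using \<open>n > 0\<close> by (simp add: \<delta>_def field_simps)
    then show ?thesis by (simp add: f_def)
  qed
  ultimately show ?thesis by blast
qed

section \<open>Positive definite functions\<close>

text \<open>Positive definiteness for an arbitrary finite index set in place of an initial segment of the
  natural numbers.\<close>
lemma positive_definite_kernelD:
  assumes K: "positive_definite_kernel K"
    and I: "finite I" "inj_on z I" and a: "\<exists>i\<in>I. a i \<noteq> 0"
  shows "(\<Sum>i\<in>I. \<Sum>j\<in>I. a i * a j * K (z i) (z j)) > 0"
proof -
  obtain h where h: "bij_betw h {..<card I} I"
    using ex_bij_betw_nat_finite[OF I(1)] atLeast0LessThan by metis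
  have "(\<Sum>i\<in>I. \<Sum>j\<in>I. a i * a j * K (z i) (z j))
      = (\<Sum>i<card I. \<Sum>j<card I. a (h i) * a (h j) * K (z (h i)) (z (h j)))"
    by (simp add: sum.reindex_bij_betw[OF h, symmetric])
  moreover have "inj_on (\<lambda>i. z (h i)) {..<card I}"
    using comp_inj_on[of h "{..<card I}" z] h I(2) by (simp add: bij_betw_def o_def)
  moreover have "\<exists>i<card I. a (h i) \<noteq> 0"
    using a h by (metis bij_betw_imp_surj_on imageE lessThan_iff)
  ultimately show ?thesis
    using K[unfolded positive_definite_kernel_def, THEN conjunct2, THEN spec[of _ "card I"],
      THEN spec[of _ "\<lambda>i. a (h i)"], THEN spec[of _ "\<lambda>i. z (h i)"]]
    by simp
qed

context
  fixes \<Phi> :: "'a::real_normed_vector \<Rightarrow> real"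
  assumes pd: "positive_definite_kernel (\<lambda>u v. \<Phi> (u - v))"
begin

lemma pd_function_even: "\<Phi> (- u) = \<Phi> u"
  using pd unfolding positive_definite_kernel_def by (metis diff_0 diff_zero)

lemma pd_function_zero_pos: "\<Phi> 0 > 0"
  using positive_definite_kernelD[OF pd, of "{0}" id "\<lambda>_. 1"] by simp

lemma pd_function_abs_le: "\<bar>\<Phi> u\<bar> \<le> \<Phi> 0"
proof (cases "u = 0")
  case True
  then show ?thesis using pd_function_zero_pos by simp
next
  case False
  have "0 < 2 * \<Phi> 0 + 2 * \<Phi> u"
    using positive_definite_kernelD[OF pd, of "{0, u}" id "\<lambda>_. 1"]
      False pd_function_even[of u] by (simp add: ex_disj_distrib)
  moreover have "0 < 2 * \<Phi> 0 - 2 * \<Phi> u"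
    using positive_definite_kernelD[OF pd, of "{0, u}" id "\<lambda>x. if x = 0 then -1 else 1"]
      False pd_function_even[of u] by simp
  ultimately show ?thesis by simp
qed

text \<open>The Cauchy--Schwarz inequality for the kernel, applied to the difference of the point masses at \<open>u\<close> and \<open>v\<close>
  and the point mass at \<open>0\<close>.  The points \<open>u\<close>,
  \<open>v\<close>, \<open>0\<close> must be distinct for strict positive definiteness to say anything, hence the case
  distinction.\<close>
lemma pd_function_increment_le: "(\<Phi> u - \<Phi> v)\<^sup>2 \<le> 2 * \<Phi> 0 * (\<Phi> 0 - \<Phi> (u - v))"
proof -
  note pos = pd_function_zero_pos
  \<comment> \<open>Two of the three points coincide: boundedness by \<open>\<Phi> 0\<close> is enough.\<close>
  have zero: "(\<Phi> w - \<Phi> 0)\<^sup>2 \<le> 2 * \<Phi> 0 * (\<Phi> 0 - \<Phi> w)" for w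
  proof -
    have "(\<Phi> 0 - \<Phi> w) * (\<Phi> 0 - \<Phi> w) \<le> 2 * \<Phi> 0 * (\<Phi> 0 - \<Phi> w)"
      using pd_function_abs_le[of w] by (intro mult_right_mono) auto
    then show ?thesis by (simp add: power2_eq_square algebra_simps)
  qed
  consider "u = v" | "v = 0" | "u = 0" | "u \<noteq> v" "u \<noteq> 0" "v \<noteq> 0" by blast
  then show ?thesis
  proof cases
    case 1 then show ?thesis by simp
  next
    case 2 then show ?thesis using zero[of u] by simp
  next
    case 3 then show ?thesis using zero[of v] pd_function_even[of v] by (simp add: power2_commute)
  next
    case 4
    \<comment> \<open>This weight at \<open>0\<close> minimises the quadratic form with weights \<open>1\<close> at \<open>u\<close> and \<open>-1\<close> at \<open>v\<close>.\<close>
    let ?t = "(\<Phi> v - \<Phi> u) / \<Phi> 0"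
    have "0 < 2 * (\<Phi> 0 - \<Phi> (u - v)) + 2 * t * (\<Phi> u - \<Phi> v) + t\<^sup>2 * \<Phi> 0" for t
      using positive_definite_kernelD[OF pd, of "{u, v, 0}" id
          "\<lambda>x. if x = u then 1 else if x = v then -1 else t"]
        4 pd_function_even[of u] pd_function_even[of v] pd_function_even[of "u - v"]
      by (auto simp: power2_eq_square algebra_simps)
    then have "0 < 2 * (\<Phi> 0 - \<Phi> (u - v)) + 2 * ?t * (\<Phi> u - \<Phi> v) + ?t\<^sup>2 * \<Phi> 0" .
    also have "\<dots> = (2 * \<Phi> 0 * (\<Phi> 0 - \<Phi> (u - v)) - (\<Phi> u - \<Phi> v)\<^sup>2) / \<Phi> 0"
      using pos by (simp add: field_simps power2_eq_square)
    finally show ?thesis using pos by (simp add: zero_less_divide_iff)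
  qed
qed

text \<open>The modulus of continuity at the origin controls the increments everywhere, by the previous
  inequality.\<close>
lemma pd_function_uniformly_continuous:
  assumes cont: "isCont \<Phi> 0"
  shows "uniformly_continuous_on UNIV \<Phi>"
  unfolding uniformly_continuous_on_def
proof (intro allI impI)
  fix e :: real assume e: "e > 0"
  note pos = pd_function_zero_pos
  have "e\<^sup>2 / (2 * \<Phi> 0) > 0" using e pos by simp
  then obtain d where d: "d > 0" "\<And>w. dist w 0 < d \<Longrightarrow> dist (\<Phi> w) (\<Phi> 0) < e\<^sup>2 / (2 * \<Phi> 0)"
    using cont unfolding continuous_at_eps_delta dist_norm by (metis diff_zero)
  have "dist (\<Phi> v) (\<Phi> u) < e" if "dist v u < d" for u v
  proof -
    have "\<Phi> 0 - \<Phi> (v - u) < e\<^sup>2 / (2 * \<Phi> 0)"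
      using d(2)[of "v - u"] that by (simp add: dist_norm)
    then have "2 * \<Phi> 0 * (\<Phi> 0 - \<Phi> (v - u)) < e\<^sup>2"
      using pos by (simp add: field_simps)
    then have "(\<Phi> v - \<Phi> u)\<^sup>2 < e\<^sup>2"
      using pd_function_increment_le[of v u] by linarith
    then show ?thesis
      using e power2_less_imp_less[of "\<bar>\<Phi> v - \<Phi> u\<bar>" e] by (simp add: dist_real_def)
  qed
  then show "\<exists>d>0. \<forall>x\<in>UNIV. \<forall>x'\<in>UNIV. dist x' x < d \<longrightarrow> dist (\<Phi> x') (\<Phi> x) < e"
    using d(1) by blast
qed

end

text \<open>If \<open>\<bar>f z\<bar>\<close> is at least \<open>e\<close>, then uniform continuity keeps \<open>\<bar>f\<bar>\<close> above \<open>e / 2\<close> on a ball around \<open>z\<close> of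
  a radius independent of \<open>z\<close>.  Far from the origin this is more mass than the tail of the integral
  contains.\<close>
lemma uniformly_continuous_integrable_tendsto_0:
  fixes f :: "'a::euclidean_space \<Rightarrow> real"
  assumes uc: "uniformly_continuous_on UNIV f" and f: "integrable lborel f"
  shows "(f \<longlongrightarrow> 0) at_infinity"
  unfolding tendsto_iff eventually_at_infinity
proof (intro allI impI)
  fix e :: real assume e: "e > 0"
  obtain d where d: "d > 0" "\<And>x y. dist y x < d \<Longrightarrow> dist (f y) (f x) < e / 2"
    using uc e unfolding uniformly_continuous_on_def by (metis UNIV_I half_gt_zero)
  have [measurable]: "f \<in> borel_measurable borel"
    using f by (auto dest: borel_measurable_integrable)
  let ?tail = "\<lambda>k x. indicator {x. real k \<le> norm x} x * \<bar>f x\<bar>"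
  let ?V = "measure lborel (ball (0::'a) d)"
  have V: "?V > 0" using content_ball_pos[OF d(1), of "0::'a"] .
  have int: "integrable lborel (?tail k)" for k
    by (rule Bochner_Integration.integrable_bound[OF f]) (auto simp: indicator_def)
  have "(\<lambda>k. LINT x|lborel. ?tail k x) \<longlonglongrightarrow> (LINT x|(lborel::'a measure). 0)"
  proof (rule integral_dominated_convergence[where w = "\<lambda>x. \<bar>f x\<bar>"])
    show "AE x in lborel. (\<lambda>k. ?tail k x) \<longlonglongrightarrow> 0"
    proof (intro AE_I2 tendsto_eventually)
      fix x :: 'a
      obtain k where "norm x < real k" using reals_Archimedean2 by blast
      then show "eventually (\<lambda>k. ?tail k x = 0) sequentially"
        by (intro eventually_sequentiallyI[of k]) (auto simp: indicator_def)
    qed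
  qed (use f in \<open>auto simp: indicator_def\<close>)
  moreover have "?V * (e / 2) > 0" using V e by simp
  ultimately have "eventually (\<lambda>k. (LINT x|lborel. ?tail k x) < ?V * (e / 2)) sequentially"
    by (intro order_tendstoD(2)[where y = 0]) auto
  then obtain k where k: "(LINT x|lborel. ?tail k x) < ?V * (e / 2)"
    by (auto simp: eventually_sequentially)
  have "dist (f z) 0 < e" if z: "norm z \<ge> real k + d" for z
  proof (rule ccontr)
    assume "\<not> dist (f z) 0 < e"
    then have big: "e \<le> \<bar>f z\<bar>" by simp
    have le: "indicator (ball z d) x * (e / 2) \<le> ?tail k x" for x
    proof (cases "x \<in> ball z d")
      case True
      then have "real k \<le> norm x"
        using z norm_triangle_ineq2[of z x] by (simp add: dist_norm)
      moreover have "\<bar>f x - f z\<bar> < e / 2"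
        using d(2)[of x z] True by (simp add: dist_commute dist_real_def)
      then have "e / 2 \<le> \<bar>f x\<bar>"
        using big by arith
      ultimately show ?thesis by (simp add: indicator_def)
    qed (simp add: indicator_def)
    have ib: "integrable lborel (indicator (ball z d) :: 'a \<Rightarrow> real)"
      using emeasure_lborel_ball_finite[of z d] by (auto simp: less_top)
    have "?V * (e / 2) = measure lborel (ball z d) * (e / 2)"
      using d(1) by (simp add: content_ball)
    also have "\<dots> = (LINT x|lborel. indicator (ball z d) x * (e / 2))"
      by simp
    also have "\<dots> \<le> (LINT x|lborel. ?tail k x)"
      by (intro integral_mono integrable_mult_left ib int le)
    finally show False using k by simp
  qed
  then show "\<exists>b. \<forall>x. b \<le> norm x \<longrightarrow> dist (f x) 0 < e" by blast
qed

section \<open>Positive definite matrices\<close>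

lemma positive_definite_matrix_invertible:
  fixes A :: "real^'n^'n"
  assumes "\<And>v. v \<noteq> 0 \<Longrightarrow> v \<bullet> (A *v v) > 0"
  shows "invertible A"
  using assms by (metis inner_zero_right less_irrefl invertible_left_inverse matrix_left_invertible_ker)

text \<open>The segment from the identity to \<open>A\<close> consists of positive definite, hence invertible, matrices,
  so the determinant keeps the sign it has at the identity.\<close>
lemma positive_definite_matrix_det_pos:
  fixes A :: "real^'n^'n"
  assumes A: "\<And>v. v \<noteq> 0 \<Longrightarrow> v \<bullet> (A *v v) > 0"
  shows "det A > 0"
proof (rule ccontr)
  assume "\<not> det A > 0"
  define H where "H t = (1 - t) *\<^sub>R mat 1 + t *\<^sub>R A" for t :: real
  have H_det: "det (H t) \<noteq> 0" if "0 \<le> t" "t \<le> 1" for t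
  proof -
    have "v \<bullet> (H t *v v) > 0" if "v \<noteq> 0" for v
    proof -
      have "v \<bullet> (H t *v v) = (1 - t) * (v \<bullet> v) + t * (v \<bullet> (A *v v))"
        unfolding H_def by (simp add: matrix_vector_mult_add_rdistrib scaleR_matrix_vector_assoc[symmetric] inner_add_right)
      moreover have "v \<bullet> v > 0" "v \<bullet> (A *v v) > 0" using that A by auto
      ultimately show ?thesis
        using \<open>0 \<le> t\<close> \<open>t \<le> 1\<close>
        by (cases "t = 0") (auto intro: add_nonneg_pos)
    qed
    then show ?thesis
      using positive_definite_matrix_invertible invertible_det_nz by blast
  qed
  have "continuous_on {0..1} (\<lambda>t. det (H t))"
    unfolding H_def det_def by (intro continuous_intros)
  then obtain t where "0 \<le> t" "t \<le> 1" "det (H t) = 0"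
    using IVT2'[of "\<lambda>t. det (H t)" 1 0 0] \<open>\<not> det A > 0\<close> by (auto simp: H_def)
  then show False using H_det by blast
qed

section \<open>Minimisation over the magnitude parameter\<close>

text \<open>With \<open>u = q / (N * s\<^sup>2)\<close> the objective exceeds the claimed minimum by \<open>N * (u - 1 - ln u)\<close>, which is
  nonnegative and vanishes only for \<open>u = 1\<close>.\<close>
lemma is_arg_min_profile:
  fixes q N C :: real
  assumes "q > 0" "N > 0"
  shows "is_arg_min (\<lambda>s. 1 / s\<^sup>2 * q + C + N * ln (s\<^sup>2)) (\<lambda>s. s > 0) s \<longleftrightarrow> s = sqrt (q / N)"
    and "s > 0 \<Longrightarrow> N + C + N * ln (q / N) \<le> 1 / s\<^sup>2 * q + C + N * ln (s\<^sup>2)"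
    and "1 / (sqrt (q / N))\<^sup>2 * q + C + N * ln ((sqrt (q / N))\<^sup>2) = N + C + N * ln (q / N)"
proof -
  let ?L = "\<lambda>s. 1 / s\<^sup>2 * q + C + N * ln (s\<^sup>2)"
  let ?u = "\<lambda>s. q / (N * s\<^sup>2)"
  have gap: "?L s - (N + C + N * ln (q / N)) = N * (?u s - 1 - ln (?u s))" if "s > 0" for s
  proof -
    have l: "ln (q / N) = ln (?u s) + ln (s\<^sup>2)"
      using that assms by (simp add: ln_div ln_mult)
    have u: "1 / s\<^sup>2 * q = N * ?u s" using assms that by simp
    show ?thesis unfolding l u by (simp only: ring_distribs mult_1_right)
  qed
  have pos: "?u s > 0" if "s > 0" for s using that assms by simp
  show min_val: "?L (sqrt (q / N)) = N + C + N * ln (q / N)"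
    using assms by simp
  show le: "N + C + N * ln (q / N) \<le> ?L s" if "s > 0" for s
  proof -
    have "0 \<le> N * (?u s - 1 - ln (?u s))"
      using ln_le_minus_one[OF pos[OF that]] assms by (intro mult_nonneg_nonneg) auto
    then show ?thesis using gap[OF that] by linarith
  qed
  have strict: "s = sqrt (q / N)" if "s > 0" "?L s \<le> N + C + N * ln (q / N)" for s
  proof -
    have "N * (?u s - 1 - ln (?u s)) \<le> 0" using gap[OF that(1)] that(2) by linarith
    then have "ln (?u s) = ?u s - 1"
      using ln_le_minus_one[OF pos[OF that(1)]] assms by (simp add: mult_le_0_iff)
    then have "?u s = 1" using ln_eq_minus_one pos[OF that(1)] by blast
    then have "s\<^sup>2 = q / N" using assms that by (simp add: field_simps)
    then show ?thesis using that(1) by (metis abs_of_pos real_sqrt_abs)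
  qed
  show "is_arg_min ?L (\<lambda>s. s > 0) s \<longleftrightarrow> s = sqrt (q / N)"
  proof
    assume "is_arg_min ?L (\<lambda>s. s > 0) s"
    then have "s > 0" "\<not> (sqrt (q / N) > 0 \<and> ?L (sqrt (q / N)) < ?L s)"
      unfolding is_arg_min_def by blast+
    moreover have "sqrt (q / N) > 0" using assms by simp
    ultimately show "s = sqrt (q / N)" using strict[of s] min_val by linarith
  next
    assume "s = sqrt (q / N)"
    then show "is_arg_min ?L (\<lambda>s. s > 0) s"
      using assms min_val le by (fastforce simp: is_arg_min_def not_less)
  qed
qed

section \<open>Determinants of scaled kernel matrices\<close>

lemma kernel_matrix_quadratic_form:
  fixes x :: "'n::finite \<Rightarrow> 'a"
  shows "v \<bullet> (kernel_matrix K x *v v) = (\<Sum>i\<in>UNIV. \<Sum>j\<in>UNIV. v $ i * v $ j * K (x i) (x j))"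
  by (simp add: kernel_matrix_def inner_vec_def matrix_vector_mult_def sum_distrib_left mult_ac)

lemma scaled_kernel_eq: "scaled_kernel \<Phi> l x y = \<Phi> (x /\<^sub>R l - y /\<^sub>R l)"
  by (simp add: scaled_kernel_def scaleR_diff_right)

lemma scaled_kernel_matrix_pos_def:
  fixes x :: "'n::finite \<Rightarrow> 'a::real_normed_vector"
  assumes pd: "positive_definite_kernel (\<lambda>u v. \<Phi> (u - v))" and x: "inj x" and l: "l > 0" and v: "v \<noteq> 0"
  shows "v \<bullet> (kernel_matrix (scaled_kernel \<Phi> l) x *v v) > 0"
proof -
  have "inj (\<lambda>i. x i /\<^sub>R l)" using x l by (auto simp: inj_on_def)
  moreover have "\<exists>i. v $ i \<noteq> 0" using v by (metis vec_eq_iff zero_index)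
  ultimately show ?thesis
    using positive_definite_kernelD[OF pd, of UNIV "\<lambda>i. x i /\<^sub>R l" "\<lambda>i. v $ i"]
    by (simp add: kernel_matrix_quadratic_form scaled_kernel_eq)
qed

lemma tendsto_det_kernel_matrix:
  fixes x :: "'n::finite \<Rightarrow> 'a"
  assumes "\<And>i j. ((\<lambda>l. k l (x i) (x j)) \<longlongrightarrow> A $ i $ j) F"
  shows "((\<lambda>l. det (kernel_matrix (k l) x)) \<longlongrightarrow> det A) F"
  unfolding det_def kernel_matrix_def vec_lambda_beta by (intro tendsto_intros assms)

text \<open>As the scale grows, all entries of the kernel matrix tend to \<open>\<Phi> 0\<close>, and a constant matrix with at
  least two rows is singular.\<close>
lemma tendsto_det_flat_limit:
  fixes x :: "'n::finite \<Rightarrow> 'a::real_normed_vector"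
  assumes cont: "isCont \<Phi> 0" and n: "CARD('n) \<ge> 2"
  shows "((\<lambda>l. det (kernel_matrix (scaled_kernel \<Phi> l) x)) \<longlongrightarrow> 0) at_top"
proof -
  let ?A = "\<chi> (i::'n) (j::'n). \<Phi> 0"
  have "((\<lambda>l. scaled_kernel \<Phi> l (x i) (x j)) \<longlongrightarrow> ?A $ i $ j) at_top" for i j
  proof -
    have "((\<lambda>l. inverse l *\<^sub>R (x i - x j)) \<longlongrightarrow> 0 *\<^sub>R (x i - x j)) at_top"
      by (intro tendsto_intros tendsto_inverse_0_at_top filterlim_ident)
    then have "((\<lambda>l. \<Phi> (inverse l *\<^sub>R (x i - x j))) \<longlongrightarrow> \<Phi> 0) at_top"
      by (intro isCont_tendsto_compose[OF cont]) simp
    then show ?thesis by (simp add: scaled_kernel_def)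
  qed
  then have "((\<lambda>l. det (kernel_matrix (scaled_kernel \<Phi> l) x)) \<longlongrightarrow> det ?A) at_top"
    by (rule tendsto_det_kernel_matrix)
  moreover have "det ?A = 0"
  proof -
    obtain i j :: 'n where "i \<noteq> j"
      using n by (metis UNIV_I card_1_singletonE card_le_Suc0_iff_eq finite numeral_2_eq_2 not_less_eq_eq)
    then show ?thesis by (intro det_identical_rows[of i j]) (auto simp: row_def)
  qed
  ultimately show ?thesis by simp
qed

text \<open>As the scale shrinks, distinct points move infinitely far apart and the kernel matrix tends to
  \<open>\<Phi> 0\<close> times the identity.\<close>
lemma tendsto_det_peaked_limit:
  fixes x :: "'n::finite \<Rightarrow> 'a::real_normed_vector"
  assumes lim: "(\<Phi> \<longlongrightarrow> 0) at_infinity" and x: "inj x"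
  shows "((\<lambda>l. det (kernel_matrix (scaled_kernel \<Phi> l) x)) \<longlongrightarrow> \<Phi> 0 ^ CARD('n)) (at_right 0)"
proof -
  let ?A = "\<chi> (i::'n) (j::'n). if i = j then \<Phi> 0 else 0"
  have "((\<lambda>l. scaled_kernel \<Phi> l (x i) (x j)) \<longlongrightarrow> ?A $ i $ j) (at_right 0)" for i j
  proof (cases "i = j")
    case True
    then show ?thesis by (simp add: scaled_kernel_def)
  next
    case False
    then have "x i - x j \<noteq> 0" using x by (auto simp: inj_on_def)
    then have "filterlim (\<lambda>l. norm (x i - x j) * inverse l) at_top (at_right 0)"
      by (intro filterlim_tendsto_pos_mult_at_top[OF tendsto_const] filterlim_inverse_at_top_right) auto
    moreover have ev: "eventually (\<lambda>l. norm (x i - x j) * inverse l = norm ((x i - x j) /\<^sub>R l)) (at_right 0)"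
      using eventually_at_right_less[of "0::real"] by eventually_elim (simp add: mult.commute)
    ultimately have "filterlim (\<lambda>l. norm ((x i - x j) /\<^sub>R l)) at_top (at_right 0)"
      using filterlim_cong[OF refl refl ev] by blast
    then have "filterlim (\<lambda>l. (x i - x j) /\<^sub>R l) at_infinity (at_right 0)"
      by (rule filterlim_norm_at_top_imp_at_infinity)
    then have "((\<lambda>l. \<Phi> ((x i - x j) /\<^sub>R l)) \<longlongrightarrow> 0) (at_right 0)"
      by (rule filterlim_compose[OF lim])
    then show ?thesis using False by (simp add: scaled_kernel_def)
  qed
  then have "((\<lambda>l. det (kernel_matrix (scaled_kernel \<Phi> l) x)) \<longlongrightarrow> det ?A) (at_right 0)"
    by (rule tendsto_det_kernel_matrix)
  moreover have "det ?A = \<Phi> 0 ^ CARD('n)"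
    by (subst det_diagonal) auto
  ultimately show ?thesis by simp
qed

text \<open>Near \<open>0\<close> the determinant is close to its positive limit; on the remaining compact interval of scales
  it is continuous and positive.\<close>
lemma det_scaled_kernel_bounded_below:
  fixes x :: "'n::finite \<Rightarrow> 'a::euclidean_space"
  assumes pd: "positive_definite_kernel (\<lambda>u v. \<Phi> (u - v))"
    and cont: "continuous_on UNIV \<Phi>" and int: "integrable lborel \<Phi>" and x: "inj x"
  shows "\<exists>\<eta>>0. \<forall>l. 0 < l \<and> l \<le> b \<longrightarrow> \<eta> \<le> det (kernel_matrix (scaled_kernel \<Phi> l) x)"
proof -
  let ?D = "\<lambda>l. det (kernel_matrix (scaled_kernel \<Phi> l) x)"
  have isCont: "isCont \<Phi> y" for y using cont by (simp add: continuous_on_eq_continuous_at)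
  have D_pos: "?D l > 0" if "l > 0" for l
    using scaled_kernel_matrix_pos_def[OF pd x that] by (rule positive_definite_matrix_det_pos)
  have "(\<Phi> \<longlongrightarrow> 0) at_infinity"
    using pd_function_uniformly_continuous[OF pd isCont] int
    by (rule uniformly_continuous_integrable_tendsto_0)
  then have "(?D \<longlongrightarrow> \<Phi> 0 ^ CARD('n)) (at_right 0)"
    using x by (rule tendsto_det_peaked_limit)
  moreover have p: "\<Phi> 0 ^ CARD('n) > 0" using pd_function_zero_pos[OF pd] by simp
  ultimately have "eventually (\<lambda>l. \<Phi> 0 ^ CARD('n) / 2 < ?D l) (at_right 0)"
    by (intro order_tendstoD(1)) auto
  then obtain e where e: "e > 0" "\<And>l. 0 < l \<Longrightarrow> l < e \<Longrightarrow> \<Phi> 0 ^ CARD('n) / 2 < ?D l"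
    by (auto simp: eventually_at_right_field)
  have D_cont: "continuous_on {e..max e b} ?D"
    unfolding det_def kernel_matrix_def scaled_kernel_def using e(1)
    by (simp, intro continuous_intros continuous_on_compose2[OF cont]) auto
  obtain t where t: "t \<in> {e..max e b}" "\<And>l. l \<in> {e..max e b} \<Longrightarrow> ?D t \<le> ?D l"
    using continuous_attains_inf[OF compact_Icc _ D_cont] by auto
  have "?D t > 0" using t(1) e(1) by (intro D_pos) auto
  moreover have "min (?D t) (\<Phi> 0 ^ CARD('n) / 2) \<le> ?D l" if "0 < l" "l \<le> b" for l
  proof (cases "l < e")
    case True
    then show ?thesis using e(2)[OF that(1)] by simp
  next
    case False
    then show ?thesis using t(2)[of l] that(2) by auto
  qed
  ultimately show ?thesis using p by (intro exI[of _ "min (?D t) (\<Phi> 0 ^ CARD('n) / 2)"]) auto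
qed

section \<open>Quadratic forms of inverse matrices\<close>

lemma matrix_inv_right_cancel:
  fixes A :: "real^'n^'n"
  assumes "invertible A"
  shows "A *v (matrix_inv A *v v) = v"
proof -
  have "A ** matrix_inv A = mat 1"
    using assms unfolding invertible_def matrix_inv_def by (metis (mono_tags, lifting) someI_ex)
  then show ?thesis by (simp add: matrix_vector_mul_assoc)
qed

text \<open>Write \<open>Z = K b\<close>.  The form \<open>q = Z \<bullet> b\<close> equals both \<open>b \<bullet> K b\<close> and \<open>c\<close> times the sum of the entries of
  \<open>b\<close>, so coercivity says \<open>\<delta> q\<^sup>2 \<le> c\<^sup>2 q\<close>.\<close>
lemma inverse_form_of_constant_le:
  fixes K :: "real^'n^'n"
  assumes inv: "invertible K" and "\<delta> > 0"
    and coercive: "\<And>v. \<delta> * (\<Sum>i\<in>UNIV. v $ i)\<^sup>2 \<le> v \<bullet> (K *v v)"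
    and Z: "Z = (\<chi> i. c)"
  shows "Z \<bullet> (matrix_inv K *v Z) \<le> c\<^sup>2 / \<delta>"
proof -
  define b where "b = matrix_inv K *v Z"
  let ?q = "Z \<bullet> b"
  have Kb: "K *v b = Z" unfolding b_def by (rule matrix_inv_right_cancel[OF inv])
  have q: "?q = c * (\<Sum>i\<in>UNIV. b $ i)"
    by (simp add: Z inner_vec_def sum_distrib_left)
  have "\<delta> * (\<Sum>i\<in>UNIV. b $ i)\<^sup>2 \<le> ?q"
    using coercive[of b] by (simp add: Kb inner_commute)
  then have le: "c\<^sup>2 * (\<delta> * (\<Sum>i\<in>UNIV. b $ i)\<^sup>2) \<le> c\<^sup>2 * ?q"
    by (intro mult_left_mono) auto
  have "?q * (\<delta> * ?q) = c\<^sup>2 * (\<delta> * (\<Sum>i\<in>UNIV. b $ i)\<^sup>2)"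
    by (simp add: q power2_eq_square)
  also have "\<dots> \<le> ?q * c\<^sup>2" using le by (simp add: mult.commute)
  finally have *: "?q * (\<delta> * ?q) \<le> ?q * c\<^sup>2" .
  have "\<delta> * ?q \<le> c\<^sup>2"
  proof (cases "?q > 0")
    case True
    then show ?thesis using * by simp
  next
    case False
    then have "\<delta> * ?q \<le> 0" using \<open>\<delta> > 0\<close> by (simp add: mult_le_0_iff)
    then show ?thesis using zero_le_power2[of c] by linarith
  qed
  then show ?thesis using \<open>\<delta> > 0\<close> unfolding b_def by (simp add: field_simps)
qed

text \<open>Expand the nonnegative form of \<open>K\<close> at \<open>matrix_inv K *v Z - (1 / M) *\<^sub>R Z\<close>.\<close>
lemma inverse_form_ge:
  fixes K :: "real^'n^'n"
  assumes inv: "invertible K" and nonneg: "\<And>v. 0 \<le> v \<bullet> (K *v v)"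
    and sym: "\<And>u v. u \<bullet> (K *v v) = v \<bullet> (K *v u)"
    and M: "M > 0" "Z \<bullet> (K *v Z) \<le> M * (Z \<bullet> Z)"
  shows "(Z \<bullet> Z) / M \<le> Z \<bullet> (matrix_inv K *v Z)"
proof -
  define b where "b = matrix_inv K *v Z"
  have Kb: "K *v b = Z" unfolding b_def by (rule matrix_inv_right_cancel[OF inv])
  have "0 \<le> (b - (1 / M) *\<^sub>R Z) \<bullet> (K *v (b - (1 / M) *\<^sub>R Z))" by (rule nonneg)
  also have "\<dots> = b \<bullet> Z - (1 / M) * (b \<bullet> (K *v Z)) - (1 / M) * (Z \<bullet> Z) + (1 / M)\<^sup>2 * (Z \<bullet> (K *v Z))"
    by (simp add: matrix_vector_mult_diff_distrib matrix_vector_mult_scaleR Kb inner_diff_left inner_diff_right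
        power2_eq_square algebra_simps)
  also have "b \<bullet> (K *v Z) = Z \<bullet> Z" using sym[of b Z] by (simp add: Kb)
  also have "b \<bullet> Z - (1 / M) * (Z \<bullet> Z) - (1 / M) * (Z \<bullet> Z) + (1 / M)\<^sup>2 * (Z \<bullet> (K *v Z))
      \<le> b \<bullet> Z - (1 / M) * (Z \<bullet> Z) - (1 / M) * (Z \<bullet> Z) + (1 / M)\<^sup>2 * (M * (Z \<bullet> Z))"
    using M by (intro add_left_mono mult_left_mono) auto
  also have "\<dots> = b \<bullet> Z - (Z \<bullet> Z) / M"
    using M(1) by (simp add: power2_eq_square)
  finally show ?thesis unfolding b_def by (simp add: inner_commute)
qed

section \<open>Divergence of the likelihood\<close>

theorem theorem3p5:
  fixes \<Phi> :: "real^'d \<Rightarrow> real"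
    and m :: "real^'d \<Rightarrow> real"
    and x :: "'n::finite \<Rightarrow> real^'d"
    and Y :: "real^'n"
    and C1 C2 \<alpha> :: real
  assumes "CARD('n) \<ge> 2"
    and "inj x"
    and "positive_definite_kernel (\<lambda>u v. \<Phi> (u - v))"
    and "continuous_on UNIV \<Phi>"
    and "integrable lborel \<Phi>"
    and "C1 > 0" and "C2 > 0" and "\<alpha> > real CARD('d) / 2"
    and "\<And>\<xi>. fourier_transform \<Phi> \<xi> \<in> \<real> \<and>
           C1 * (1 + (norm \<xi>)\<^sup>2) powr (- \<alpha>) \<le> Re (fourier_transform \<Phi> \<xi>) \<and>
           Re (fourier_transform \<Phi> \<xi>) \<le> C2 * (1 + (norm \<xi>)\<^sup>2) powr (- \<alpha>)"
    and "m_constant m x Y"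
    and "centred_data m x Y \<noteq> 0"
  shows "filterlim (\<lambda>l. ell \<Phi> m x Y l (sigma_ML (ell \<Phi> m x Y) l)) at_bot at_top \<and>
         lambda_ML_infinite (ell \<Phi> m x Y)"
proof -
  note pd = assms(3) and cont = assms(4) and int = assms(5)
  define L where "L = ell \<Phi> m x Y"
  define N where "N = real CARD('n)"
  define K where "K l = kernel_matrix (scaled_kernel \<Phi> l) x" for l
  define Z where "Z = centred_data m x Y"
  define q where "q l = Z \<bullet> (matrix_inv (K l) *v Z)" for l
  obtain c where Z_const: "Z = (\<chi> i. c)"
    using assms(10) unfolding m_constant_def Z_def by blast
  have Z0: "Z \<noteq> 0" using assms(11) by (simp add: Z_def)
  then have c0: "c \<noteq> 0" by (auto simp: Z_const vec_eq_iff)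
  have N: "N > 0" by (simp add: N_def)
  have \<Phi>0: "\<Phi> 0 > 0" by (rule pd_function_zero_pos[OF pd])
  have ZZ: "Z \<bullet> Z = N * c\<^sup>2"
    by (simp add: Z_const inner_vec_def N_def power2_eq_square)

  define c' where "c' = C1 * (1 + (real CARD('n))\<^sup>2) powr (- \<alpha>)"
  have c': "c' > 0" unfolding c'_def using \<open>C1 > 0\<close>
    by (intro mult_pos_pos) (auto simp: add_pos_nonneg powr_gt_zero less_imp_neq[symmetric])
  have "0 < \<alpha>" using assms(8) by (smt (verit) divide_nonneg_nonneg of_nat_0_le_iff)
  \<comment> \<open>A ball of radius \<open>n\<close> suffices: Turan's inequality on the unit ball involves multiples up to \<open>n \<xi>\<close>.\<close>
  have lower: "c' \<le> Re (fourier_transform \<Phi> \<xi>)" if "norm \<xi> \<le> real CARD('n)" for \<xi>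
  proof -
    have "(1 + (real CARD('n))\<^sup>2) powr (- \<alpha>) \<le> (1 + (norm \<xi>)\<^sup>2) powr (- \<alpha>)"
      using \<open>0 < \<alpha>\<close> that by (intro powr_mono2') (auto intro: add_pos_nonneg power_mono)
    then have "c' \<le> C1 * (1 + (norm \<xi>)\<^sup>2) powr (- \<alpha>)"
      unfolding c'_def using \<open>C1 > 0\<close> by (intro mult_left_mono) auto
    then show ?thesis using assms(9)[of \<xi>] by linarith
  qed
  have nonneg: "0 \<le> Re (fourier_transform \<Phi> \<xi>)" for \<xi>
  proof -
    have "0 \<le> C1 * (1 + (norm \<xi>)\<^sup>2) powr (- \<alpha>)" using \<open>C1 > 0\<close> by simp
    then show ?thesis using assms(9)[of \<xi>] by linarith
  qed
  obtain \<delta> where \<delta>: "\<delta> > 0"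
    and coercive: "\<And>I (z :: 'n \<Rightarrow> real^'d) a. finite I \<Longrightarrow> card I = CARD('n) \<Longrightarrow>
        \<delta> * (\<Sum>i\<in>I. a i)\<^sup>2 \<le> (\<Sum>i\<in>I. \<Sum>j\<in>I. a i * a j * \<Phi> (z i - z j))"
    using quadratic_form_ge_square_of_sum[where 'i = 'n,
        OF cont int pd_function_abs_le[OF pd] nonneg lower c' zero_less_card_finite]
    by blast

  have K_pd: "v \<bullet> (K l *v v) > 0" if "l > 0" "v \<noteq> 0" for l v
    unfolding K_def using scaled_kernel_matrix_pos_def[OF pd assms(2) that] .
  have K_nonneg: "0 \<le> v \<bullet> (K l *v v)" if "l > 0" for l v
    using K_pd[OF that, of v] by (cases "v = 0") auto
  have K_inv: "invertible (K l)" and D_pos: "det (K l) > 0" if "l > 0" for l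
    using K_pd[OF that] by (auto intro: positive_definite_matrix_invertible positive_definite_matrix_det_pos)
  have K_coercive: "\<delta> * (\<Sum>i\<in>UNIV. v $ i)\<^sup>2 \<le> v \<bullet> (K l *v v)" for l v
    unfolding K_def kernel_matrix_quadratic_form scaled_kernel_eq
    by (rule coercive) auto
  have K_sym: "u \<bullet> (K l *v v) = v \<bullet> (K l *v u)" for l u v
  proof -
    have "K l $ i $ j = K l $ j $ i" for i j
      using pd_function_even[OF pd, of "(x i - x j) /\<^sub>R l"]
      by (simp add: K_def kernel_matrix_def scaled_kernel_def scaleR_diff_right)
    then have "transpose (K l) = K l" by (simp add: vec_eq_iff transpose_def)
    then have "u \<bullet> (K l *v v) = (K l *v u) \<bullet> v"
      using dot_lmul_matrix[of u "K l" v] transpose_matrix_vector[of "K l" u] by simp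
    then show ?thesis by (simp only: inner_commute)
  qed
  \<comment> \<open>The bound is uniform in \<open>l\<close> because \<open>\<delta>\<close> was chosen before the points.\<close>
  have q_le: "q l \<le> c\<^sup>2 / \<delta>" if "l > 0" for l
    unfolding q_def
    by (rule inverse_form_of_constant_le[OF K_inv[OF that] \<delta> K_coercive Z_const])
  have q_ge: "c\<^sup>2 / \<Phi> 0 \<le> q l" if "l > 0" for l
  proof -
    have "Z \<bullet> (K l *v Z) \<le> (\<Sum>i\<in>(UNIV::'n set). \<Sum>j\<in>(UNIV::'n set). c * c * \<Phi> 0)"
      unfolding K_def kernel_matrix_quadratic_form Z_const scaled_kernel_def vec_lambda_beta
      by (intro sum_mono mult_left_mono zero_le_square pd_function_abs_le[OF pd, THEN abs_le_D1])
    also have "\<dots> = (N * \<Phi> 0) * (Z \<bullet> Z)"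
      by (simp add: ZZ N_def power2_eq_square)
    finally have "(Z \<bullet> Z) / (N * \<Phi> 0) \<le> q l"
      unfolding q_def using N \<Phi>0
      by (intro inverse_form_ge K_inv[OF that] K_nonneg[OF that] K_sym) auto
    then show ?thesis using N by (simp add: ZZ)
  qed
  have q_pos: "q l > 0" if "l > 0" for l
    using q_ge[OF that] c0 \<Phi>0 by (smt (verit) divide_pos_pos zero_less_power2)

  have L_eq: "L l = (\<lambda>s. 1 / s\<^sup>2 * q l + ln (det (K l)) + N * ln (s\<^sup>2))" for l
    by (rule ext) (simp add: L_def ell_def Let_def K_def q_def N_def Z_def)
  have sigma: "sigma_ML L l = sqrt (q l / N)" if "l > 0" for l
    unfolding sigma_ML_def L_eq is_arg_min_profile(1)[OF q_pos[OF that] N] by simp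
  have profile: "L l (sigma_ML L l) = N + ln (det (K l)) + N * ln (q l / N)" if "l > 0" for l
    unfolding sigma[OF that] L_eq by (rule is_arg_min_profile(3)[OF q_pos[OF that] N])
  have L_ge: "N + ln (det (K l)) + N * ln (q l / N) \<le> L l s" if "l > 0" "s > 0" for l s
    unfolding L_eq by (rule is_arg_min_profile(2)[OF q_pos[OF that(1)] N that(2)])

  have lim: "filterlim (\<lambda>l. L l (sigma_ML L l)) at_bot at_top"
  proof -
    have "((\<lambda>l. det (K l)) \<longlongrightarrow> 0) at_top"
      unfolding K_def using cont assms(1)
      by (intro tendsto_det_flat_limit) (auto simp: continuous_on_eq_continuous_at)
    moreover have "eventually (\<lambda>l. det (K l) > 0) at_top"
      using eventually_gt_at_top[of 0] by eventually_elim (rule D_pos)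
    ultimately have "filterlim (\<lambda>l. det (K l)) (at_right 0) at_top"
      by (auto simp: filterlim_at elim: eventually_mono)
    then have ln_lim: "filterlim (\<lambda>l. ln (det (K l))) at_bot at_top"
      by (rule filterlim_compose[OF ln_at_0])
    show ?thesis
      unfolding filterlim_at_bot
    proof
      fix B
      have "eventually (\<lambda>l. ln (det (K l)) \<le> B - N - N * ln (c\<^sup>2 / \<delta> / N)) at_top"
        using ln_lim unfolding filterlim_at_bot by blast
      then show "eventually (\<lambda>l. L l (sigma_ML L l) \<le> B) at_top"
        using eventually_gt_at_top[of 0]
      proof eventually_elim
        case (elim l)
        have "ln (q l / N) \<le> ln (c\<^sup>2 / \<delta> / N)"
          using q_le[OF elim(2)] q_pos[OF elim(2)] N by (intro ln_mono divide_right_mono) auto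
        then have "N * ln (q l / N) \<le> N * ln (c\<^sup>2 / \<delta> / N)"
          using N by (intro mult_left_mono) auto
        then show ?case using elim(1) unfolding profile[OF elim(2)] by linarith
      qed
    qed
  qed
  have inf: "(INF (l, s)\<in>{0<..} \<times> {0<..}. ereal (L l s)) = - \<infinity>"
  proof (rule ereal_bot)
    fix B :: real
    have "eventually (\<lambda>l. L l (sigma_ML L l) \<le> B \<and> l > 0) at_top"
      using lim eventually_gt_at_top[of 0] unfolding filterlim_at_bot by (auto intro: eventually_conj)
    then obtain l where l: "L l (sigma_ML L l) \<le> B" "l > 0"
      by (auto simp: eventually_at_top_linorder)
    then have "sigma_ML L l > 0" using sigma q_pos N by simp
    then have "(INF (l, s)\<in>{0<..} \<times> {0<..}. ereal (L l s)) \<le> ereal (L l (sigma_ML L l))"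
      using l(2) by (intro INF_lower2[of "(l, sigma_ML L l)"]) auto
    also have "\<dots> \<le> ereal B" using l(1) by simp
    finally show "(INF (l, s)\<in>{0<..} \<times> {0<..}. ereal (L l s)) \<le> ereal B" .
  qed
  have "lambda_ML_infinite L"
    unfolding lambda_ML_infinite_def inf
  proof (intro allI impI, elim conjE)
    fix lam sig :: "nat \<Rightarrow> real"
    assume pos: "\<forall>k. lam k > 0 \<and> sig k > 0"
      and conv: "(\<lambda>k. ereal (L (lam k) (sig k))) \<longlonglongrightarrow> - \<infinity>"
    show "filterlim lam at_top sequentially"
      unfolding filterlim_at_top
    proof
      fix b
      obtain \<eta> where \<eta>: "\<eta> > 0" "\<And>l. 0 < l \<Longrightarrow> l \<le> b \<Longrightarrow> \<eta> \<le> det (K l)"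
        using det_scaled_kernel_bounded_below[OF pd cont int assms(2), of b] unfolding K_def by blast
      let ?B = "N + ln \<eta> + N * ln (c\<^sup>2 / \<Phi> 0 / N)"
      have "eventually (\<lambda>k. ereal (L (lam k) (sig k)) < ereal ?B) sequentially"
        using conv unfolding tendsto_MInfty by blast
      then show "eventually (\<lambda>k. b \<le> lam k) sequentially"
      proof eventually_elim
        case (elim k)
        show ?case
        proof (rule ccontr)
          assume "\<not> b \<le> lam k"
          moreover have l: "lam k > 0" and s: "sig k > 0" using pos by auto
          ultimately have "ln \<eta> \<le> ln (det (K (lam k)))" using \<eta> by (intro ln_mono) auto
          moreover have "ln (c\<^sup>2 / \<Phi> 0 / N) \<le> ln (q (lam k) / N)"
            using q_ge[OF l] c0 \<Phi>0 N by (intro ln_mono divide_right_mono) auto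
          then have "N * ln (c\<^sup>2 / \<Phi> 0 / N) \<le> N * ln (q (lam k) / N)"
            using N by (intro mult_left_mono) auto
          ultimately have "?B \<le> L (lam k) (sig k)" using L_ge[OF l s] by linarith
          then show False using elim by simp
        qed
      qed
    qed
  qed
  then show ?thesis using lim unfolding L_def by blast
qed

end
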